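(* Let $T$ be a punctual tree (viewed as a partial order) of finite height such that one of the following holds: (1) $T$ has at least two nodes each having infinitely many immediate successors; or (2) $T$ has exactly one node with infinitely many immediate successors, and each of these successors has an immediate successor of its own. Then $\mathrm{PrCat}(T)\subseteq\mathrm{Cone}(\Delta^0_1)$.
   Context: A tree is a partial order with a least element (the root) in which the set of predecessors of every node is a finite linear order; it has finite height if there is a finite bound on the lengths of chains. A node $b$ is an immediate successor of $a$ if $a<b$ and there is no $c$ with $a<c<b$. A structure is punctual if its domain is $\omega$ and its relations are uniformly primitive recursive. For total $f,g:\omega\to\omega$, write $f\le_{PR}g$ if $f$ is primitive recursive relative to $g$; the induced equivalence classes are PR-degrees, and $f\le_{PR}\mathbf d$ means $f\le_{PR}$ a member of $\mathbf d$. For a punctual structure $A$, $\mathrm{PrCat}(A)$ is the set of PR-degrees $\mathbf d$ such that for every punctual $B\cong A$ there is an isomorphism $f:A\to B$ with $f\le_{PR}\mathbf d$ and $f^{-1}\le_{PR}\mathbf d$. $\mathrm{Cone}(\Delta^0_1)$ is the set of PR-degrees $\mathbf d$ such that $f\le_{PR}\mathbf d$ for every total computable function $f:\omega\to\omega$. *)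

theory Defs
  imports Main
begin

subsection \<open>Partial recursive functions with an oracle\<close>

text \<open>
  Arities are implicit: a program applied to a list of length $n$ acts as an $n$-ary partial
  function. \<open>Oracle\<close> calls the oracle, and \<open>Mu\<close> is unbounded search. In \<open>PrimRec p q\<close> the
  recursion variable is the first argument, and \<open>q\<close> receives the recursion variable, the previous
  value and the parameters, in this order. A program whose arities do not match gets stuck.
\<close>

datatype recf =
    Zero
  | Succ
  | Proj nat
  | Oracle
  | Comp recf "recf list"
  | PrimRec recf recf
  | Mu recf

inductive computes :: "(nat \<Rightarrow> nat) \<Rightarrow> recf \<Rightarrow> nat list \<Rightarrow> nat \<Rightarrow> bool" for g where
  zero: "computes g Zero xs 0"
| succ: "computes g Succ [x] (Suc x)"
| proj: "i < length xs \<Longrightarrow> computes g (Proj i) xs (xs ! i)"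
| oracle_call: "computes g Oracle [x] (g x)"
| comp: "list_all2 (\<lambda>q y. computes g q xs y) qs ys \<Longrightarrow> computes g p ys z
    \<Longrightarrow> computes g (Comp p qs) xs z"
| primrec_0: "computes g p xs y \<Longrightarrow> computes g (PrimRec p q) (0 # xs) y"
| primrec_Suc: "computes g (PrimRec p q) (n # xs) r \<Longrightarrow> computes g q (n # r # xs) y
    \<Longrightarrow> computes g (PrimRec p q) (Suc n # xs) y"
| mu: "computes g p (n # xs) 0 \<Longrightarrow> (\<And>m. m < n \<Longrightarrow> \<exists>v. computes g p (m # xs) (Suc v))
    \<Longrightarrow> computes g (Mu p) xs n"

fun mu_free :: "recf \<Rightarrow> bool" where
  "mu_free (Comp p qs) = (mu_free p \<and> (\<forall>q \<in> set qs. mu_free q))"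
| "mu_free (PrimRec p q) = (mu_free p \<and> mu_free q)"
| "mu_free (Mu p) = False"
| "mu_free _ = True"

fun oracle_free :: "recf \<Rightarrow> bool" where
  "oracle_free Oracle = False"
| "oracle_free (Comp p qs) = (oracle_free p \<and> (\<forall>q \<in> set qs. oracle_free q))"
| "oracle_free (PrimRec p q) = (oracle_free p \<and> oracle_free q)"
| "oracle_free (Mu p) = oracle_free p"
| "oracle_free _ = True"

text \<open>For oracle-free programs the oracle argument of \<^const>\<open>computes\<close> is a dummy.\<close>

definition computable :: "(nat \<Rightarrow> nat) \<Rightarrow> bool" where
  "computable f \<longleftrightarrow> (\<exists>p. oracle_free p \<and> (\<forall>x. computes (\<lambda>_. 0) p [x] (f x)))"

definition prim_rec_rel :: "nat rel \<Rightarrow> bool" where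
  "prim_rec_rel R \<longleftrightarrow> (\<exists>p. mu_free p \<and> oracle_free p \<and>
     (\<forall>x y. computes (\<lambda>_. 0) p [x, y] (if (x, y) \<in> R then 1 else 0)))"


subsection \<open>PR-degrees\<close>

definition pr_le :: "(nat \<Rightarrow> nat) \<Rightarrow> (nat \<Rightarrow> nat) \<Rightarrow> bool"  (infix "\<le>PR" 50) where
  "f \<le>PR g \<longleftrightarrow> (\<exists>p. mu_free p \<and> (\<forall>x. computes g p [x] (f x)))"

definition pr_equiv :: "(nat \<Rightarrow> nat) rel" where
  "pr_equiv = {(f, g). f \<le>PR g \<and> g \<le>PR f}"

definition pr_degrees :: "(nat \<Rightarrow> nat) set set" where
  "pr_degrees = UNIV // pr_equiv"

definition pr_le_degree :: "(nat \<Rightarrow> nat) \<Rightarrow> (nat \<Rightarrow> nat) set \<Rightarrow> bool"  (infix "\<le>PRdeg" 50) where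
  "f \<le>PRdeg d \<longleftrightarrow> (\<exists>g \<in> d. f \<le>PR g)"

definition Cone_computable :: "(nat \<Rightarrow> nat) set set" where
  "Cone_computable = {d \<in> pr_degrees. \<forall>f. computable f \<longrightarrow> f \<le>PRdeg d}"


subsection \<open>Punctual structures in the language of one binary relation\<close>

text \<open>
  A structure with domain $\omega$ is given by its relation. As there is just one relation,
  uniformity of the primitive recursive relations is automatic.
\<close>

definition punctual :: "nat rel \<Rightarrow> bool" where
  "punctual A \<longleftrightarrow> prim_rec_rel A"

definition isomorphism :: "nat rel \<Rightarrow> nat rel \<Rightarrow> (nat \<Rightarrow> nat) \<Rightarrow> bool" where
  "isomorphism A B f \<longleftrightarrow> bij f \<and> (\<forall>x y. (x, y) \<in> A \<longleftrightarrow> (f x, f y) \<in> B)"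

definition isomorphic :: "nat rel \<Rightarrow> nat rel \<Rightarrow> bool" where
  "isomorphic A B \<longleftrightarrow> (\<exists>f. isomorphism A B f)"

definition PrCat :: "nat rel \<Rightarrow> (nat \<Rightarrow> nat) set set" where
  "PrCat A = {d \<in> pr_degrees. \<forall>B. punctual B \<and> isomorphic A B \<longrightarrow>
     (\<exists>f. isomorphism A B f \<and> f \<le>PRdeg d \<and> inv f \<le>PRdeg d)}"


subsection \<open>Trees\<close>

text \<open>
  Trees are represented by their non-strict order: \<open>(a, b) \<in> T\<close> means $a \le b$.
\<close>

definition predecessors :: "'a rel \<Rightarrow> 'a \<Rightarrow> 'a set" where
  "predecessors T a = {b. (b, a) \<in> T \<and> b \<noteq> a}"

definition is_tree :: "'a rel \<Rightarrow> bool" where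
  "is_tree T \<longleftrightarrow> partial_order_on UNIV T \<and> (\<exists>r. \<forall>a. (r, a) \<in> T) \<and>
     (\<forall>a. finite (predecessors T a) \<and>
          linear_order_on (predecessors T a) (Restr T (predecessors T a)))"

definition finite_height :: "'a rel \<Rightarrow> bool" where
  "finite_height T \<longleftrightarrow> (\<exists>h. \<forall>C \<in> Chains T. finite C \<and> card C \<le> h)"

definition immediate_succs :: "'a rel \<Rightarrow> 'a \<Rightarrow> 'a set" where
  "immediate_succs T a = {b. (a, b) \<in> T - Id \<and> \<not> (\<exists>c. (a, c) \<in> T - Id \<and> (c, b) \<in> T - Id)}"

end

theory Submission
  imports Defs
begin

text \<open>
  Let \<open>f\<close> be computable and let \<open>a\<close> have infinitely many immediate successors. One copy of \<open>T\<close>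
  shows an infinite antichain above \<open>a\<close> at once and holds back every other node \<open>z\<close> until the
  computations of \<open>f x\<close> for \<open>x \<le> z\<close> have halted. A second copy shows at once infinitely many nodes
  that no automorphism of \<open>T\<close> can move into the antichain, up to a fraction: the antichains above
  two different nodes, or infinitely many comparable pairs above \<open>a\<close>. Hence an isomorphism from the
  second copy to the first sends one of its first \<open>4 x + C\<close> elements to a node \<open>z \<ge> x\<close> that is held
  back, and the position of this node bounds the running time of \<open>f\<close> on \<open>x\<close>.
\<close>

subsection \<open>Replacing the oracle\<close>

text \<open>\<open>PrCat\<close> only promises some isomorphisms, so their composite is known up to
  an automorphism of \<open>T\<close>; the nodes shown early in the second copy must therefore
  escape under every automorphism. The obstacle is to keep the copies punctual: what a subtree looks
  like is settled only in the limit. Antichain and pairs are chosen by inspecting numerically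
  smaller nodes only, in such a way that a node can be comparable with a much later chosen one only
  if it lies at or below \<open>a\<close>. For pairs this fails as long as a node above
  \<open>a\<close> has no known neighbour, so the second copy holds such nodes back as well; that
  each successor of \<open>a\<close> has a successor of its own ensures that this wait ends. The
  factor 4 is a product of two halves: one node out of two escapes, and at least every second
  position of a copy is free for an early node.\<close>

primrec subst_oracle :: "recf \<Rightarrow> recf \<Rightarrow> recf" where
  "subst_oracle q Zero = Zero"
| "subst_oracle q Succ = Succ"
| "subst_oracle q (Proj i) = Proj i"
| "subst_oracle q Oracle = q"
| "subst_oracle q (Comp p qs) = Comp (subst_oracle q p) (map (subst_oracle q) qs)"
| "subst_oracle q (PrimRec p r) = PrimRec (subst_oracle q p) (subst_oracle q r)"
| "subst_oracle q (Mu p) = Mu (subst_oracle q p)"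

lemma computes_subst_oracle:
  assumes "computes g p xs y" and q: "\<And>x. computes h q [x] (g x)"
  shows "computes h (subst_oracle q p) xs y"
  using assms(1)
proof (induction rule: computes.induct)
  case (comp xs qs ys p z)
  have "list_all2 (\<lambda>q y. computes h q xs y) (map (subst_oracle q) qs) ys"
    using comp(1) by (simp add: list_all2_map1 list_all2_mono)
  then show ?case using comp by (auto intro: computes.comp)
next
  case (mu p n xs)
  then show ?case unfolding subst_oracle.simps by (metis computes.mu)
qed (simp_all add: computes.zero computes.succ computes.proj q computes.primrec_0
      computes.primrec_Suc)

lemma mu_free_subst_oracle: "mu_free p \<Longrightarrow> mu_free q \<Longrightarrow> mu_free (subst_oracle q p)"
  by (induction p) auto

lemma oracle_free_subst_oracle: "oracle_free q \<Longrightarrow> oracle_free (subst_oracle q p)"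
  by (induction p) auto

lemma pr_le_trans: "f \<le>PR g \<Longrightarrow> g \<le>PR h \<Longrightarrow> f \<le>PR h"
  unfolding pr_le_def by (meson computes_subst_oracle mu_free_subst_oracle)


subsection \<open>Primitive recursive functions of an environment\<close>

text \<open>
  Only finitely many entries of the environment matter; quantifying over all sufficiently large
  arities lets functions of different arities be combined without bookkeeping.
\<close>

definition prim_rec_fun :: "(nat \<Rightarrow> nat) \<Rightarrow> ((nat \<Rightarrow> nat) \<Rightarrow> nat) \<Rightarrow> bool" where
  "prim_rec_fun g F \<longleftrightarrow>
     (\<exists>N. \<forall>n\<ge>N. \<exists>p. mu_free p \<and> (\<forall>e. computes g p (map e [0..<n]) (F e)))"

definition prim_rec_pred :: "(nat \<Rightarrow> nat) \<Rightarrow> ((nat \<Rightarrow> nat) \<Rightarrow> bool) \<Rightarrow> bool" where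
  "prim_rec_pred g R \<longleftrightarrow> prim_rec_fun g (\<lambda>e. of_bool (R e))"

lemma map_case_nat_upt: "map (case_nat m e) [0..<Suc n] = m # map e [0..<n]"
  by (simp add: map_upt_Suc del: upt_Suc)

lemma prim_rec_fun_var: "prim_rec_fun g (\<lambda>e. e k)"
proof -
  have "computes g (Proj k) (map e [0..<n]) (e k)" if "n \<ge> Suc k" for n e
    using computes.proj[of k "map e [0..<n]" g] that by simp
  then show ?thesis unfolding prim_rec_fun_def by (meson mu_free.simps)
qed

text \<open>Composition in the form of a substitution. A program for \<open>F\<close> at one fixed
  arity \<open>k\<close> reads only the first \<open>k\<close> terms, so finitely many thresholds
  matter and their sum bounds each of them.\<close>

lemma prim_rec_fun_compose:
  assumes F: "prim_rec_fun g F" and t: "\<And>i. prim_rec_fun g (t i)"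
  shows "prim_rec_fun g (\<lambda>e. F (\<lambda>i. t i e))"
proof -
  obtain k p where p: "mu_free p" "\<And>e. computes g p (map e [0..<k]) (F e)"
    using F unfolding prim_rec_fun_def by blast
  obtain N where N: "\<And>i n. n \<ge> N i \<Longrightarrow>
      \<exists>p. mu_free p \<and> (\<forall>e. computes g p (map e [0..<n]) (t i e))"
    using t unfolding prim_rec_fun_def by metis
  have "\<exists>r. mu_free r \<and> (\<forall>e. computes g r (map e [0..<n]) (F (\<lambda>i. t i e)))"
    if n: "n \<ge> (\<Sum>i<k. N i)" for n
  proof -
    have "n \<ge> N i" if "i < k" for i
      using n that member_le_sum[of i "{..<k}" N] by simp
    then obtain q where q: "\<And>i. i < k \<Longrightarrow>
        mu_free (q i) \<and> (\<forall>e. computes g (q i) (map e [0..<n]) (t i e))"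
      using N[of _ n] by metis
    have "computes g (Comp p (map q [0..<k])) (map e [0..<n]) (F (\<lambda>i. t i e))" for e
      using q p(2)[of "\<lambda>i. t i e"]
      by (auto intro!: computes.comp[where ys = "map (\<lambda>i. t i e) [0..<k]"]
          simp: list_all2_conv_all_nth)
    moreover have "mu_free (Comp p (map q [0..<k]))" using p q by auto
    ultimately show ?thesis by blast
  qed
  then show ?thesis unfolding prim_rec_fun_def by blast
qed

lemma prim_rec_fun_comp1:
  "prim_rec_fun g (\<lambda>e. F (e 0)) \<Longrightarrow> prim_rec_fun g t \<Longrightarrow> prim_rec_fun g (\<lambda>e. F (t e))"
  using prim_rec_fun_compose[of g "\<lambda>e. F (e 0)" "\<lambda>_. t"] by simp

lemma prim_rec_fun_comp2:
  assumes "prim_rec_fun g (\<lambda>e. F (e 0) (e (Suc 0)))" "prim_rec_fun g t" "prim_rec_fun g u"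
  shows "prim_rec_fun g (\<lambda>e. F (t e) (u e))"
  using prim_rec_fun_compose[OF assms(1), of "\<lambda>i. if i = 0 then t else u"] assms by simp

lemma prim_rec_fun_comp3:
  assumes "prim_rec_fun g (\<lambda>e. F (e 0) (e (Suc 0)) (e (Suc (Suc 0))))"
    "prim_rec_fun g t" "prim_rec_fun g u" "prim_rec_fun g v"
  shows "prim_rec_fun g (\<lambda>e. F (t e) (u e) (v e))"
  using prim_rec_fun_compose[OF assms(1), of "\<lambda>i. if i = 0 then t else if i = 1 then u else v"]
    assms by simp

lemma prim_rec_fun_Suc:
  assumes "prim_rec_fun g t" shows "prim_rec_fun g (\<lambda>e. Suc (t e))"
proof -
  have "computes g (Comp Succ [p]) xs (Suc y)" if "computes g p xs y" for p xs y
    using that by (auto intro!: computes.comp[where ys = "[y]"] computes.succ)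
  moreover have "mu_free (Comp Succ [p])" if "mu_free p" for p using that by simp
  ultimately show ?thesis using assms unfolding prim_rec_fun_def by meson
qed

lemma prim_rec_fun_const: "prim_rec_fun g (\<lambda>e. c)"
proof (induction c)
  case 0
  show ?case unfolding prim_rec_fun_def by (meson computes.zero mu_free.simps)
qed (rule prim_rec_fun_Suc)

lemma prim_rec_fun_case_nat:
  "prim_rec_fun g a \<Longrightarrow> (\<And>j. prim_rec_fun g (b j)) \<Longrightarrow>
    prim_rec_fun g (\<lambda>e. case i of 0 \<Rightarrow> a e | Suc j \<Rightarrow> b j e)"
  by (cases i) simp_all

text \<open>In the step function the counter and the previous value occupy variables 0 and 1 and the
  old environment is shifted by two, which matches the argument order of
  \<open>PrimRec\<close>.\<close>

lemma prim_rec_fun_rec: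
  assumes b: "prim_rec_fun g b"
    and s: "prim_rec_fun g (\<lambda>e. s (e 0) (e (Suc 0)) (\<lambda>i. e (Suc (Suc i))))"
    and m: "prim_rec_fun g m"
  shows "prim_rec_fun g (\<lambda>e. rec_nat (b e) (\<lambda>k r. s k r e) (m e))"
proof -
  obtain Nb Ns where Nb: "\<And>n. n \<ge> Nb \<Longrightarrow>
      \<exists>p. mu_free p \<and> (\<forall>e. computes g p (map e [0..<n]) (b e))"
    and Ns: "\<And>n. n \<ge> Ns \<Longrightarrow> \<exists>p. mu_free p \<and>
      (\<forall>e. computes g p (map e [0..<n]) (s (e 0) (e (Suc 0)) (\<lambda>i. e (Suc (Suc i)))))"
    using b s unfolding prim_rec_fun_def by meson
  have "prim_rec_fun g (\<lambda>e. rec_nat (b (\<lambda>i. e (Suc i)))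
          (\<lambda>k r. s k r (\<lambda>i. e (Suc i))) (e 0))"
    unfolding prim_rec_fun_def
  proof (rule exI[of _ "Suc (Nb + Ns)"], intro allI impI)
    fix n assume n: "n \<ge> Suc (Nb + Ns)"
    then obtain l where l: "n = Suc l" "l \<ge> Nb" "Suc (Suc l) \<ge> Ns" by (cases n) auto
    obtain p where p: "mu_free p" "\<And>e. computes g p (map e [0..<l]) (b e)"
      using Nb l by blast
    obtain q where q: "mu_free q" "\<And>e. computes g q (map e [0..<Suc (Suc l)])
        (s (e 0) (e (Suc 0)) (\<lambda>i. e (Suc (Suc i))))"
      using Ns[OF l(3)] by blast
    have step: "computes g q (k # r # map e [0..<l]) (s k r e)" for k r e
      using q(2)[of "case_nat k (case_nat r e)"] by (simp add: map_case_nat_upt del: upt_Suc)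
    have rec: "computes g (PrimRec p q) (k # map e [0..<l])
        (rec_nat (b e) (\<lambda>k r. s k r e) k)" for k e
      by (induction k) (simp_all add: computes.primrec_0 p computes.primrec_Suc[OF _ step])
    have "computes g (PrimRec p q) (map e [0..<n]) (rec_nat (b (\<lambda>i. e (Suc i)))
          (\<lambda>k r. s k r (\<lambda>i. e (Suc i))) (e 0))" for e
    proof -
      have "map e [0..<n] = e 0 # map (\<lambda>i. e (Suc i)) [0..<l]"
        unfolding l(1) by (rule map_upt_Suc)
      then show ?thesis using rec by simp
    qed
    then show "\<exists>p. mu_free p \<and> (\<forall>e. computes g p (map e [0..<n])
        (rec_nat (b (\<lambda>i. e (Suc i))) (\<lambda>k r. s k r (\<lambda>i. e (Suc i))) (e 0)))"
      using p q by (intro exI[of _ "PrimRec p q"]) simp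
  qed
  \<comment> \<open>So far the number of steps is variable 0; substituting \<open>m\<close> for it
    and shifting the other variables back gives the general form.\<close>
  moreover have "prim_rec_fun g (\<lambda>e. if i = 0 then m e else e (i - 1))" for i
    by (cases i) (simp_all add: m prim_rec_fun_var)
  ultimately have "prim_rec_fun g (\<lambda>e. rec_nat (b (\<lambda>i. if Suc i = 0 then m e else e (Suc i - 1)))
      (\<lambda>k r. s k r (\<lambda>i. if Suc i = 0 then m e else e (Suc i - 1)))
      (if 0 = (0::nat) then m e else e (0 - 1)))"
    by (rule prim_rec_fun_compose)
  then show ?thesis by simp
qed

lemma prim_rec_fun_oracle:
  assumes "f \<le>PR g" "prim_rec_fun g t"
  shows "prim_rec_fun g (\<lambda>e. f (t e))"
proof -
  obtain p where "mu_free p" "\<And>x. computes g p [x] (f x)"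
    using assms(1) unfolding pr_le_def by blast
  then have "computes g (Comp p [Proj 0]) (map e [0..<n]) (f (e 0))" if "n \<ge> 1" for n e
    using that computes.proj[of 0 "map e [0..<n]" g]
    by (auto intro!: computes.comp[where ys = "[e 0]"])
  then have "prim_rec_fun g (\<lambda>e. f (e 0))"
    using \<open>mu_free p\<close> unfolding prim_rec_fun_def
    by (intro exI[of _ 1] allI impI exI[of _ "Comp p [Proj 0]"]) auto
  from prim_rec_fun_comp1[OF this assms(2)] show ?thesis .
qed

lemma pr_le_iff_prim_rec_fun: "f \<le>PR g \<longleftrightarrow> prim_rec_fun g (\<lambda>e. f (e 0))"
proof
  assume "prim_rec_fun g (\<lambda>e. f (e 0))"
  then obtain n p where p: "mu_free p" "\<And>e. computes g p (map e [0..<n]) (f (e 0))"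
    unfolding prim_rec_fun_def by blast
  have "computes g (Comp p (replicate n (Proj 0))) [x] (f x)" for x
    using p(2)[of "\<lambda>_. x"] computes.proj[of 0 "[x]" g]
    by (auto intro!: computes.comp[where ys = "map (\<lambda>_. x) [0..<n]"]
        simp: list_all2_conv_all_nth)
  then show "f \<le>PR g"
    using p(1) unfolding pr_le_def by (intro exI[of _ "Comp p (replicate n (Proj 0))"]) auto
qed (rule prim_rec_fun_oracle, auto intro: prim_rec_fun_var)

lemma prim_rec_fun_change_oracle:
  assumes "prim_rec_fun g F" "g \<le>PR h" shows "prim_rec_fun h F"
  using assms unfolding prim_rec_fun_def pr_le_def
  by (meson computes_subst_oracle mu_free_subst_oracle)

lemma zero_pr_le: "(\<lambda>_. 0) \<le>PR g"
  unfolding pr_le_iff_prim_rec_fun by (rule prim_rec_fun_const)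

lemmas prim_rec_fun_any_oracle = prim_rec_fun_change_oracle[OF _ zero_pr_le]

lemma prim_rec_pred_comp1:
  "prim_rec_pred g (\<lambda>e. R (e 0)) \<Longrightarrow> prim_rec_fun g t \<Longrightarrow> prim_rec_pred g (\<lambda>e. R (t e))"
  unfolding prim_rec_pred_def by (rule prim_rec_fun_comp1)

lemma prim_rec_pred_comp2:
  "prim_rec_pred g (\<lambda>e. R (e 0) (e (Suc 0))) \<Longrightarrow> prim_rec_fun g t \<Longrightarrow> prim_rec_fun g u
    \<Longrightarrow> prim_rec_pred g (\<lambda>e. R (t e) (u e))"
  unfolding prim_rec_pred_def by (rule prim_rec_fun_comp2)

lemma prim_rec_pred_comp3:
  "prim_rec_pred g (\<lambda>e. R (e 0) (e (Suc 0)) (e (Suc (Suc 0)))) \<Longrightarrow> prim_rec_fun g t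
    \<Longrightarrow> prim_rec_fun g u \<Longrightarrow> prim_rec_fun g v \<Longrightarrow> prim_rec_pred g (\<lambda>e. R (t e) (u e) (v e))"
  unfolding prim_rec_pred_def by (rule prim_rec_fun_comp3)

lemma prim_rec_rel_iff:
  "prim_rec_rel A \<longleftrightarrow> prim_rec_pred (\<lambda>_. 0) (\<lambda>e. (e 0, e (Suc 0)) \<in> A)"
proof
  assume "prim_rec_rel A"
  then obtain p where p: "mu_free p"
    "\<And>x y. computes (\<lambda>_. 0) p [x, y] (of_bool ((x, y) \<in> A))"
    unfolding prim_rec_rel_def of_bool_def by blast
  have "computes (\<lambda>_. 0) (Comp p [Proj 0, Proj 1]) (map e [0..<n])
      (of_bool ((e 0, e (Suc 0)) \<in> A))" if "n \<ge> 2" for n e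
    using that computes.proj[of _ "map e [0..<n]" "\<lambda>_. 0"]
    by (intro computes.comp[where ys = "[e 0, e 1]"]) (simp_all add: p(2) del: of_bool_eq_0_iff)
  then show "prim_rec_pred (\<lambda>_. 0) (\<lambda>e. (e 0, e (Suc 0)) \<in> A)"
    using p(1) unfolding prim_rec_pred_def prim_rec_fun_def
    by (intro exI[of _ 2] allI impI exI[of _ "Comp p [Proj 0, Proj 1]"]) auto
next
  assume "prim_rec_pred (\<lambda>_. 0) (\<lambda>e. (e 0, e (Suc 0)) \<in> A)"
  then obtain n p where p: "mu_free p"
    "\<And>e. computes (\<lambda>_. 0) p (map e [0..<n]) (of_bool ((e 0, e (Suc 0)) \<in> A))"
    unfolding prim_rec_fun_def prim_rec_pred_def by blast
  let ?c = "Comp p (map (\<lambda>i. if i = 0 then Proj 0 else Proj 1) [0..<n])"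
  \<comment> \<open>The program for the predicate may call its oracle, whereas
    \<open>prim_rec_rel\<close> asks for an oracle-free one. The oracle is constantly 0, so
    \<open>Zero\<close> can answer the calls.\<close>
  let ?q = "subst_oracle Zero ?c"
  have "computes (\<lambda>_. 0) ?c [x, y] (if (x, y) \<in> A then 1 else 0)" for x y
    using p(2)[of "\<lambda>i. if i = 0 then x else y"] computes.proj[of 0 "[x, y]" "\<lambda>_. 0"]
      computes.proj[of 1 "[x, y]" "\<lambda>_. 0"]
    by (intro computes.comp[where ys = "map (\<lambda>i. if i = 0 then x else y) [0..<n]"])
      (auto simp: list_all2_conv_all_nth of_bool_def)
  then have "computes (\<lambda>_. 0) ?q [x, y] (if (x, y) \<in> A then 1 else 0)" for x y
    by (rule computes_subst_oracle) (rule computes.zero)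
  moreover have "mu_free ?c" using p(1) by auto
  then have "mu_free ?q" "oracle_free ?q"
    by (auto intro!: mu_free_subst_oracle oracle_free_subst_oracle simp del: subst_oracle.simps)
  ultimately show "prim_rec_rel A"
    unfolding prim_rec_rel_def by (intro exI[of _ ?q] conjI allI)
qed

section \<open>Closure under case distinction, connectives, bounded search and arithmetic\<close>

text \<open>A recursion along \<open>of_bool (R e)\<close> runs once or not at all.\<close>

lemma prim_rec_fun_if:
  assumes "prim_rec_pred g R" "prim_rec_fun g t" "prim_rec_fun g u"
  shows "prim_rec_fun g (\<lambda>e. if R e then t e else u e)"
proof -
  have "prim_rec_fun g (\<lambda>e. t (\<lambda>i. e (Suc (Suc i))))"
    by (rule prim_rec_fun_compose[OF assms(2)]) (rule prim_rec_fun_var)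
  from prim_rec_fun_rec[OF assms(3) this assms(1)[unfolded prim_rec_pred_def]]
  have "prim_rec_fun g (\<lambda>e. rec_nat (u e) (\<lambda>k r. t e) (of_bool (R e)))" .
  also have "(\<lambda>e. rec_nat (u e) (\<lambda>k r. t e) (of_bool (R e))) = (\<lambda>e. if R e then t e else u e)"
    by auto
  finally show ?thesis .
qed

lemma prim_rec_pred_eq_0:
  assumes "prim_rec_fun g t"
  shows "prim_rec_pred g (\<lambda>e. t e = 0)"
proof -
  have "prim_rec_fun g (\<lambda>e. rec_nat 1 (\<lambda>k r. 0) (t e))"
    by (intro prim_rec_fun_rec prim_rec_fun_const assms)
  also have "(\<lambda>e. rec_nat 1 (\<lambda>k r. 0) (t e)) = (\<lambda>e. of_bool (t e = 0))"
    by (auto simp: fun_eq_iff gr0_conv_Suc)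
  finally show ?thesis unfolding prim_rec_pred_def .
qed

lemma prim_rec_pred_const: "prim_rec_pred g (\<lambda>e. c)"
  unfolding prim_rec_pred_def by (rule prim_rec_fun_const)

lemma prim_rec_pred_conj:
  assumes "prim_rec_pred g R" "prim_rec_pred g S"
  shows "prim_rec_pred g (\<lambda>e. R e \<and> S e)"
proof -
  have "(\<lambda>e. of_bool (R e \<and> S e)) = (\<lambda>e. if R e then of_bool (S e) else (0::nat))" by auto
  then show ?thesis
    using prim_rec_fun_if[OF assms(1) assms(2)[unfolded prim_rec_pred_def] prim_rec_fun_const]
    unfolding prim_rec_pred_def by simp
qed

lemma prim_rec_pred_not:
  assumes "prim_rec_pred g R"
  shows "prim_rec_pred g (\<lambda>e. \<not> R e)"
proof -
  have "(\<lambda>e. of_bool (\<not> R e)) = (\<lambda>e. if R e then 0 else (1::nat))" by auto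
  then show ?thesis
    using prim_rec_fun_if[OF assms(1) prim_rec_fun_const prim_rec_fun_const]
    unfolding prim_rec_pred_def by simp
qed

lemma prim_rec_pred_disj:
  assumes "prim_rec_pred g R" "prim_rec_pred g S"
  shows "prim_rec_pred g (\<lambda>e. R e \<or> S e)"
  using prim_rec_pred_not[OF prim_rec_pred_conj[OF prim_rec_pred_not prim_rec_pred_not], OF assms]
  by simp

lemma prim_rec_pred_imp:
  assumes "prim_rec_pred g R" "prim_rec_pred g S"
  shows "prim_rec_pred g (\<lambda>e. R e \<longrightarrow> S e)"
  using prim_rec_pred_disj[OF prim_rec_pred_not, OF assms] by (simp only: imp_conv_disj)

lemma prim_rec_pred_if:
  assumes "prim_rec_pred g R" "prim_rec_pred g S" "prim_rec_pred g S'"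
  shows "prim_rec_pred g (\<lambda>e. if R e then S e else S' e)"
proof -
  have "(\<lambda>e. of_bool (if R e then S e else S' e)) =
      (\<lambda>e. if R e then of_bool (S e) else (of_bool (S' e) :: nat))" by auto
  then show ?thesis
    using prim_rec_fun_if[OF assms(1) assms(2,3)[unfolded prim_rec_pred_def]]
    unfolding prim_rec_pred_def by simp
qed

lemma prim_rec_pred_ex:
  assumes b: "prim_rec_fun g b" and R: "prim_rec_pred g (\<lambda>e. R (e 0) (\<lambda>i. e (Suc i)))"
  shows "prim_rec_pred g (\<lambda>e. \<exists>k<b e. R k e)"
proof -
  have R': "prim_rec_pred g (\<lambda>e. R (e 0) (\<lambda>i. e (Suc (Suc i))))"
    using prim_rec_fun_compose[OF R[unfolded prim_rec_pred_def],
        of "\<lambda>i e. e (if i = 0 then 0 else Suc i)"]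
    unfolding prim_rec_pred_def by (simp add: prim_rec_fun_var)
  have "prim_rec_fun g (\<lambda>e. rec_nat 0 (\<lambda>k r. if R k e then 1 else r) (b e))"
    by (intro prim_rec_fun_rec prim_rec_fun_const prim_rec_fun_if prim_rec_fun_var b R')
  also have "(\<lambda>e. rec_nat 0 (\<lambda>k r. if R k e then 1 else r) (b e)) = (\<lambda>e. of_bool (\<exists>k<b e. R k e))"
  proof
    fix e
    have "rec_nat 0 (\<lambda>k r. if R k e then 1 else r) n = of_bool (\<exists>k<n. R k e)" for n
      by (induction n) (auto simp: less_Suc_eq)
    then show "rec_nat 0 (\<lambda>k r. if R k e then 1 else r) (b e) = of_bool (\<exists>k<b e. R k e)" .
  qed
  finally show ?thesis unfolding prim_rec_pred_def .
qed

lemma prim_rec_pred_all: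
  assumes b: "prim_rec_fun g b" and R: "prim_rec_pred g (\<lambda>e. R (e 0) (\<lambda>i. e (Suc i)))"
  shows "prim_rec_pred g (\<lambda>e. \<forall>k<b e. R k e)"
  using prim_rec_pred_not[OF prim_rec_pred_ex[of g b "\<lambda>k e. \<not> R k e"]] prim_rec_pred_not[OF R] b
  by simp

text \<open>The disjunct \<open>b e \<le> k\<close> bounds the search, with \<open>b e\<close> as
  the value if nothing smaller works. The recursion keeps a candidate and advances it by one at each
  failure.\<close>

lemma prim_rec_fun_least:
  assumes b: "prim_rec_fun g b" and R: "prim_rec_pred g (\<lambda>e. R (e 0) (\<lambda>i. e (Suc i)))"
  shows "prim_rec_fun g (\<lambda>e. LEAST k. b e \<le> k \<or> R k e)"
proof -
  have R': "prim_rec_pred g (\<lambda>e. R (e (Suc 0)) (\<lambda>i. e (Suc (Suc i))))"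
    using prim_rec_fun_compose[OF R[unfolded prim_rec_pred_def], of "\<lambda>i e. e (Suc i)"]
    unfolding prim_rec_pred_def by (auto intro: prim_rec_fun_var)
  let ?L = "\<lambda>n e. rec_nat 0 (\<lambda>k r. if R r e then r else Suc r) n"
  have "prim_rec_fun g (\<lambda>e. ?L (b e) e)"
    by (intro prim_rec_fun_rec prim_rec_fun_const prim_rec_fun_if prim_rec_fun_var b R'
        prim_rec_fun_Suc)
  moreover have "?L n e = (LEAST k. n \<le> k \<or> R k e)" for n e
  proof -
    define L where "L n = ?L n e" for n
    have L: "L 0 = 0" "L (Suc n) = (if R (L n) e then L n else Suc (L n))" for n
      by (simp_all add: L_def)
    have "(L n = n \<or> R (L n) e) \<and> L n \<le> n \<and> (\<forall>k<L n. \<not> R k e)"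
    proof (induction n)
      case (Suc n)
      then show ?case by (cases "R (L n) e") (auto simp: L less_Suc_eq)
    qed (simp add: L)
    then have "n \<le> L n \<or> R (L n) e" "\<And>k. n \<le> k \<or> R k e \<Longrightarrow> L n \<le> k"
      by (auto simp: not_less[symmetric])
    then have "(LEAST k. n \<le> k \<or> R k e) = L n" by (rule Least_equality)
    then show ?thesis by (simp add: L_def)
  qed
  ultimately show ?thesis by simp
qed

lemma prim_rec_fun_pred:
  assumes "prim_rec_fun g t" shows "prim_rec_fun g (\<lambda>e. t e - 1)"
proof -
  have "prim_rec_fun g (\<lambda>e. rec_nat 0 (\<lambda>k r. k) (t e))"
    by (intro prim_rec_fun_rec prim_rec_fun_const prim_rec_fun_var assms)
  also have "(\<lambda>e. rec_nat 0 (\<lambda>k r. k) (t e)) = (\<lambda>e. t e - 1)"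
  proof
    show "rec_nat 0 (\<lambda>k r. k) (t e) = t e - 1" for e by (cases "t e") auto
  qed
  finally show ?thesis .
qed

lemma prim_rec_fun_diff:
  assumes "prim_rec_fun g t" "prim_rec_fun g u" shows "prim_rec_fun g (\<lambda>e. t e - u e)"
proof -
  have "prim_rec_fun g (\<lambda>e. rec_nat (t e) (\<lambda>k r. r - 1) (u e))"
    by (intro prim_rec_fun_rec prim_rec_fun_pred prim_rec_fun_var assms)
  moreover have "rec_nat m (\<lambda>k r. r - 1) n = m - n" for m n :: nat by (induction n) auto
  ultimately show ?thesis by simp
qed

lemma prim_rec_fun_add:
  assumes "prim_rec_fun g t" "prim_rec_fun g u" shows "prim_rec_fun g (\<lambda>e. t e + u e)"
proof -
  have "prim_rec_fun g (\<lambda>e. rec_nat (t e) (\<lambda>k r. Suc r) (u e))"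
    by (intro prim_rec_fun_rec prim_rec_fun_Suc prim_rec_fun_var assms)
  moreover have "rec_nat m (\<lambda>k r. Suc r) n = m + n" for m n :: nat by (induction n) auto
  ultimately show ?thesis by simp
qed

lemma prim_rec_pred_le:
  "prim_rec_fun g t \<Longrightarrow> prim_rec_fun g u \<Longrightarrow> prim_rec_pred g (\<lambda>e. t e \<le> u e)"
  using prim_rec_pred_eq_0[OF prim_rec_fun_diff] by simp

lemma prim_rec_pred_less:
  "prim_rec_fun g t \<Longrightarrow> prim_rec_fun g u \<Longrightarrow> prim_rec_pred g (\<lambda>e. t e < u e)"
  using prim_rec_pred_not[OF prim_rec_pred_le, of g u t] by (simp add: not_le)

lemma prim_rec_pred_eq:
  "prim_rec_fun g t \<Longrightarrow> prim_rec_fun g u \<Longrightarrow> prim_rec_pred g (\<lambda>e. t e = u e)"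
  using prim_rec_pred_conj[OF prim_rec_pred_le prim_rec_pred_le, of g t u u t]
  by (simp add: eq_iff[symmetric])

lemma prim_rec_pred_even:
  assumes "prim_rec_fun g t" shows "prim_rec_pred g (\<lambda>e. even (t e))"
proof -
  have "prim_rec_pred g (\<lambda>e. \<exists>k<Suc (t e). t e = k + k)"
    using prim_rec_fun_compose[OF assms, of "\<lambda>i e. e (Suc i)"]
    by (intro prim_rec_pred_ex prim_rec_pred_eq prim_rec_fun_add prim_rec_fun_Suc
        prim_rec_fun_var assms) (simp add: prim_rec_fun_var)
  also have "(\<lambda>e. \<exists>k<Suc (t e). t e = k + k) = (\<lambda>e. even (t e))"
  proof
    have "(\<exists>k<Suc n. n = k + k) = even n" for n :: nat by presburger
    then show "(\<exists>k<Suc (t e). t e = k + k) = even (t e)" for e .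
  qed
  finally show ?thesis .
qed

lemma prim_rec_fun_half:
  assumes "prim_rec_fun g t" shows "prim_rec_fun g (\<lambda>e. t e div 2)"
proof -
  have "prim_rec_fun g (\<lambda>e. LEAST k. t e \<le> k \<or> t e < Suc (Suc (k + k)))"
    using prim_rec_fun_compose[OF assms, of "\<lambda>i e. e (Suc i)"]
    by (intro prim_rec_fun_least prim_rec_pred_less prim_rec_fun_add prim_rec_fun_Suc
        prim_rec_fun_var assms) (simp add: prim_rec_fun_var)
  moreover have "(LEAST k. n \<le> k \<or> n < Suc (Suc (k + k))) = n div 2" for n :: nat
    by (rule Least_equality) auto
  ultimately show ?thesis by simp
qed

lemmas prim_rec_intros = prim_rec_fun_var prim_rec_fun_const prim_rec_fun_Suc prim_rec_fun_if
  prim_rec_fun_pred prim_rec_fun_diff prim_rec_fun_add prim_rec_fun_half prim_rec_fun_least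
  prim_rec_pred_const prim_rec_pred_conj prim_rec_pred_disj prim_rec_pred_not prim_rec_pred_imp
  prim_rec_pred_if prim_rec_pred_ex prim_rec_pred_all prim_rec_pred_le prim_rec_pred_less
  prim_rec_pred_eq prim_rec_pred_even


subsection \<open>Evaluation with bounded search\<close>

inductive_cases computes_elims:
  "computes g Zero xs y" "computes g Succ xs y" "computes g (Proj i) xs y"
  "computes g (Comp p qs) xs y" "computes g (PrimRec p q) [] y"
  "computes g (PrimRec p q) (0 # xs) y" "computes g (PrimRec p q) (Suc n # xs) y"
  "computes g (Mu p) xs y"

text \<open>
  Instead of coding programs, one bounds every unbounded search of a fixed program by a fuel
  parameter. The value \<open>0\<close> means that the fuel did not suffice and \<open>Suc y\<close> that the result is \<open>y\<close>.
\<close>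

definition fuel_evaluator :: "nat \<Rightarrow> recf \<Rightarrow> (nat \<Rightarrow> (nat \<Rightarrow> nat) \<Rightarrow> nat) \<Rightarrow> bool" where
  "fuel_evaluator n p F \<longleftrightarrow> prim_rec_fun (\<lambda>_. 0) (\<lambda>e. F (e 0) (\<lambda>i. e (Suc i)))
     \<and> (\<forall>e s t y. F s e = Suc y \<longrightarrow> s \<le> t \<longrightarrow> F t e = Suc y)
     \<and> (\<forall>e y. computes (\<lambda>_. 0) p (map e [0..<n]) y \<longrightarrow> (\<exists>s. F s e = Suc y))"

lemma fuel_evaluatorI:
  assumes "prim_rec_fun (\<lambda>_. 0) (\<lambda>e. F (e 0) (\<lambda>i. e (Suc i)))"
    and "\<And>e s t y. F s e = Suc y \<Longrightarrow> s \<le> t \<Longrightarrow> F t e = Suc y"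
    and "\<And>e y. computes (\<lambda>_. 0) p (map e [0..<n]) y \<Longrightarrow> \<exists>s. F s e = Suc y"
  shows "fuel_evaluator n p F"
  using assms unfolding fuel_evaluator_def by blast

lemma fuel_evaluator_prim_rec:
  "fuel_evaluator n p F \<Longrightarrow> prim_rec_fun (\<lambda>_. 0) (\<lambda>e. F (e 0) (\<lambda>i. e (Suc i)))"
  unfolding fuel_evaluator_def by blast

lemma fuel_evaluator_compose:
  assumes "fuel_evaluator n p F" "prim_rec_fun g t" "\<And>i. prim_rec_fun g (u i)"
  shows "prim_rec_fun g (\<lambda>e. F (t e) (\<lambda>i. u i e))"
proof -
  have "prim_rec_fun g (case i of 0 \<Rightarrow> t | Suc i \<Rightarrow> u i)" for i
    using assms by (cases i) simp_all
  with prim_rec_fun_any_oracle[OF fuel_evaluator_prim_rec[OF assms(1)]]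
  have "prim_rec_fun g (\<lambda>e. F ((case 0 of 0 \<Rightarrow> t | Suc i \<Rightarrow> u i) e)
      (\<lambda>i. (case Suc i of 0 \<Rightarrow> t | Suc i \<Rightarrow> u i) e))"
    by (rule prim_rec_fun_compose)
  then show ?thesis by simp
qed

lemma fuel_evaluator_mono: "fuel_evaluator n p F \<Longrightarrow> F s e = Suc y \<Longrightarrow> s \<le> t \<Longrightarrow> F t e = Suc y"
  unfolding fuel_evaluator_def by blast

lemma fuel_evaluator_complete:
  "fuel_evaluator n p F \<Longrightarrow> computes (\<lambda>_. 0) p (map e [0..<n]) y \<Longrightarrow> \<exists>s. F s e = Suc y"
  unfolding fuel_evaluator_def by blast

text \<open>Finitely many computations can share one amount of fuel: the sum of the individual
  amounts dominates each of them, and evaluators are monotone.\<close>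

lemma fuel_evaluator_complete_all:
  fixes k :: nat
  assumes F: "\<And>i. i < k \<Longrightarrow> fuel_evaluator (n i) (p i) (F i)"
    and c: "\<And>i. i < k \<Longrightarrow> computes (\<lambda>_. 0) (p i) (map (e i) [0..<n i]) (y i)"
  shows "\<exists>s. \<forall>t\<ge>s. \<forall>i<k. F i t (e i) = Suc (y i)"
proof -
  define s where "s i = (SOME s. F i s (e i) = Suc (y i))" for i
  have s: "F i (s i) (e i) = Suc (y i)" if "i < k" for i
    unfolding s_def by (rule someI_ex, rule fuel_evaluator_complete[OF F[OF that] c[OF that]])
  show ?thesis
  proof (intro exI allI impI)
    fix t i
    assume t: "(\<Sum>i<k. s i) \<le> t" and i: "i < k"
    have "s i \<le> t"
      by (rule order_trans[OF member_le_sum t]) (use i in auto)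
    then show "F i t (e i) = Suc (y i)"
      by (rule fuel_evaluator_mono[OF F[OF i], OF s[OF i]])
  qed
qed

lemma prim_rec_pred_finite_all:
  "(\<And>i. i < k \<Longrightarrow> prim_rec_pred g (R i)) \<Longrightarrow> prim_rec_pred g (\<lambda>e. \<forall>i<k. R i e)" for k :: nat
  by (induction k) (simp_all add: prim_rec_pred_const All_less_Suc prim_rec_pred_conj)

lemma ex_fuel_evaluator_Comp:
  assumes p: "fuel_evaluator (length qs) p F"
    and q: "\<And>i. i < length qs \<Longrightarrow> fuel_evaluator n (qs ! i) (H i)"
  shows "\<exists>G. fuel_evaluator n (Comp p qs) G"
proof -
  \<comment> \<open>Environments are infinite. Beyond \<open>length qs\<close> the default 0 keeps
    the environment passed to \<open>F\<close> unchanged when the fuel grows.\<close>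
  define H' where "H' i = (if i < length qs then H i else (\<lambda>_ _. 0))" for i
  have H': "prim_rec_fun (\<lambda>_. 0) (\<lambda>e. H' i (e 0) (\<lambda>j. e (Suc j)))" for i
    using fuel_evaluator_prim_rec[OF q[of i]]
    by (cases "i < length qs") (simp_all add: H'_def prim_rec_fun_const)
  define G where
    "G s e = (if \<forall>i<length qs. H' i s e \<noteq> 0 then F s (\<lambda>i. H' i s e - 1) else 0)" for s e
  have "fuel_evaluator n (Comp p qs) G"
  proof (rule fuel_evaluatorI)
    show "prim_rec_fun (\<lambda>_. 0) (\<lambda>e. G (e 0) (\<lambda>i. e (Suc i)))"
      unfolding G_def
      by (intro prim_rec_fun_if prim_rec_pred_finite_all prim_rec_pred_not prim_rec_pred_eq_0 H'
          fuel_evaluator_compose[OF p] prim_rec_fun_pred prim_rec_fun_var prim_rec_fun_const)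
  next
    fix e s t y
    assume G: "G s e = Suc y" and st: "s \<le> t"
    have nz: "\<forall>i<length qs. H' i s e \<noteq> 0" and F: "F s (\<lambda>i. H' i s e - 1) = Suc y"
      using G unfolding G_def by (auto split: if_splits)
    have "H' i t e = H' i s e" for i
    proof (cases "i < length qs")
      case True
      then obtain v where v: "H i s e = Suc v" using nz unfolding H'_def by (metis not0_implies_Suc)
      from fuel_evaluator_mono[OF q[OF True], OF v st] v True
      show ?thesis by (simp add: H'_def)
    qed (simp add: H'_def)
    then show "G t e = Suc y"
      using fuel_evaluator_mono[OF p, OF F st] nz by (simp add: G_def)
  next
    fix e y
    assume "computes (\<lambda>_. 0) (Comp p qs) (map e [0..<n]) y"
    then obtain ys where ys: "list_all2 (\<lambda>q y. computes (\<lambda>_. 0) q (map e [0..<n]) y) qs ys"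
      "computes (\<lambda>_. 0) p ys y" by (auto elim: computes_elims)
    then have len: "length ys = length qs" by (simp add: list_all2_lengthD)
    have c: "computes (\<lambda>_. 0) (qs ! i) (map e [0..<n]) (ys ! i)" if "i < length qs" for i
      using ys(1) that by (simp add: list_all2_conv_all_nth)
    have "\<exists>s. \<forall>t\<ge>s. \<forall>i<length qs. H i t e = Suc (ys ! i)"
      by (rule fuel_evaluator_complete_all[where n = "\<lambda>_. n" and p = "\<lambda>i. qs ! i"
            and e = "\<lambda>_. e" and y = "\<lambda>i. ys ! i", OF q c])
    then obtain s where s: "\<And>t i. t \<ge> s \<Longrightarrow> i < length qs \<Longrightarrow> H i t e = Suc (ys ! i)"
      by blast
    have ys_eq: "ys = map (\<lambda>i. H' i s e - 1) [0..<length qs]"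
      by (rule nth_equalityI) (auto simp: len H'_def s)
    have "\<exists>r. F r (\<lambda>i. H' i s e - 1) = Suc y"
      by (rule fuel_evaluator_complete[OF p]) (use ys(2) ys_eq in simp)
    then obtain r where r: "F r (\<lambda>i. H' i s e - 1) = Suc y" ..
    have "(\<lambda>i. H' i (max r s) e - 1) = (\<lambda>i. H' i s e - 1)"
      using s[of "max r s"] s[of s] by (auto simp: H'_def)
    then have "F (max r s) (\<lambda>i. H' i (max r s) e - 1) = Suc y"
      using fuel_evaluator_mono[OF p, OF r max.cobounded1, of s] by (simp only:)
    then have "G (max r s) e = Suc y"
      by (simp add: G_def) (simp add: H'_def s)
    then show "\<exists>s. G s e = Suc y" ..
  qed
  then show ?thesis by blast
qed

lemma ex_fuel_evaluator_PrimRec: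
  assumes p: "fuel_evaluator n p F" and q: "fuel_evaluator (Suc (Suc n)) q H"
  shows "\<exists>G. fuel_evaluator (Suc n) (PrimRec p q) G"
proof -
  define R where "R s e k = rec_nat (F s e)
    (\<lambda>k r. if r = 0 then 0 else H s (case_nat k (case_nat (r - 1) e))) k" for s e k
  define G where "G s e = R s (\<lambda>i. e (Suc i)) (e 0)" for s and e :: "nat \<Rightarrow> nat"
  have R_0: "R s e 0 = F s e" for s e by (simp add: R_def)
  have R_Suc: "R s e (Suc k) = (if R s e k = 0 then 0
      else H s (case_nat k (case_nat (R s e k - 1) e)))" for s e k
    by (simp add: R_def)
  have mono: "R s e k = Suc y \<Longrightarrow> R t e k = Suc y" if "s \<le> t" for s t e k y
  proof (induction k arbitrary: y)
    case 0
    then show ?case using fuel_evaluator_mono[OF p, OF _ that] unfolding R_0 by blast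
  next
    case (Suc k)
    then obtain r where r: "R s e k = Suc r" "H s (case_nat k (case_nat r e)) = Suc y"
      by (cases "R s e k") (auto simp: R_Suc)
    have "R t e k = Suc r" by (rule Suc.IH[OF r(1)])
    moreover have "H t (case_nat k (case_nat r e)) = Suc y"
      by (rule fuel_evaluator_mono[OF q, OF r(2) that])
    ultimately show ?case by (simp add: R_Suc)
  qed
  have complete: "computes (\<lambda>_. 0) (PrimRec p q) (k # map e [0..<n]) y \<Longrightarrow> \<exists>s. R s e k = Suc y"
    for k e y
  proof (induction k arbitrary: y)
    case 0
    then have "computes (\<lambda>_. 0) p (map e [0..<n]) y" by (auto elim: computes_elims)
    then show ?case unfolding R_0 by (rule fuel_evaluator_complete[OF p])
  next
    case (Suc k)
    then obtain r where r: "computes (\<lambda>_. 0) (PrimRec p q) (k # map e [0..<n]) r"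
      "computes (\<lambda>_. 0) q (k # r # map e [0..<n]) y" by (auto elim: computes_elims)
    from Suc.IH[OF r(1)] obtain s where s: "R s e k = Suc r" ..
    have "\<exists>t. H t (case_nat k (case_nat r e)) = Suc y"
      by (rule fuel_evaluator_complete[OF q]) (use r(2) in \<open>simp only: map_case_nat_upt\<close>)
    then obtain t where t: "H t (case_nat k (case_nat r e)) = Suc y" ..
    have "R (max s t) e k = Suc r" by (rule mono[OF max.cobounded1 s])
    moreover have "H (max s t) (case_nat k (case_nat r e)) = Suc y"
      by (rule fuel_evaluator_mono[OF q, OF t max.cobounded2])
    ultimately have "R (max s t) e (Suc k) = Suc y" by (simp add: R_Suc)
    then show ?case ..
  qed
  have "fuel_evaluator (Suc n) (PrimRec p q) G"
  proof (rule fuel_evaluatorI)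
    have "prim_rec_fun (\<lambda>_. 0) (\<lambda>e. case_nat (e 0) (case_nat (e (Suc 0) - 1)
        (\<lambda>i. e (Suc (Suc (Suc (Suc i)))))) i)" for i
      by (intro prim_rec_fun_case_nat prim_rec_fun_pred prim_rec_fun_var)
    then show "prim_rec_fun (\<lambda>_. 0) (\<lambda>e. G (e 0) (\<lambda>i. e (Suc i)))"
      unfolding G_def R_def
      by (intro prim_rec_fun_rec prim_rec_fun_if prim_rec_pred_eq_0 prim_rec_fun_var
          prim_rec_fun_const fuel_evaluator_compose[OF p] fuel_evaluator_compose[OF q])
  next
    show "G t e = Suc y" if "G s e = Suc y" "s \<le> t" for e s t y
      using mono that unfolding G_def by blast
  next
    show "\<exists>s. G s e = Suc y" if "computes (\<lambda>_. 0) (PrimRec p q) (map e [0..<Suc n]) y" for e y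
      using complete that unfolding G_def map_upt_Suc by blast
  qed
  then show ?thesis by blast
qed

text \<open>As values are shifted by one, 1 means that a zero is found and 0 that an argument is
  undecided. The search stops at the first value below 2 and accepts only 1; passing over an
  undecided argument would destroy monotonicity.\<close>

lemma ex_fuel_evaluator_Mu:
  assumes p: "fuel_evaluator (Suc n) p F"
  shows "\<exists>G. fuel_evaluator n (Mu p) G"
proof -
  define L where "L s e = (LEAST k. s \<le> k \<or> F s (case_nat k e) \<le> 1)" for s e
  define G where "G s e = (if L s e < s \<and> F s (case_nat (L s e) e) = 1 then Suc (L s e) else 0)"
    for s e
  have G: "G s e = Suc m \<longleftrightarrow>
      m < s \<and> F s (case_nat m e) = 1 \<and> (\<forall>k<m. \<exists>v. F s (case_nat k e) = Suc (Suc v))" for s e m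
  proof -
    have ge2: "\<not> n \<le> 1 \<longleftrightarrow> (\<exists>v. n = Suc (Suc v))" for n :: nat
      by (cases n; cases "n - 1") auto
    have "L s e = m" if "m < s" "F s (case_nat m e) = 1" "\<forall>k<m. \<not> F s (case_nat k e) \<le> 1"
      unfolding L_def using that by (intro Least_equality) (auto simp: not_less[symmetric])
    moreover have "\<not> F s (case_nat k e) \<le> 1" if "k < L s e" for k
      using not_less_Least[of k] that unfolding L_def by blast
    ultimately show ?thesis unfolding G_def ge2[symmetric] by auto
  qed
  have "fuel_evaluator n (Mu p) G"
  proof (rule fuel_evaluatorI)
    have "prim_rec_fun (\<lambda>_. 0) (\<lambda>e. case_nat (e 0) (\<lambda>i. e (Suc (Suc i))) i)" for i
      by (intro prim_rec_fun_case_nat prim_rec_fun_pred prim_rec_fun_var)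
    then have L: "prim_rec_fun (\<lambda>_. 0) (\<lambda>e. L (e 0) (\<lambda>i. e (Suc i)))"
      unfolding L_def
      by (intro prim_rec_fun_least prim_rec_pred_le prim_rec_fun_var prim_rec_fun_const
          fuel_evaluator_compose[OF p])
    then have "prim_rec_fun (\<lambda>_. 0) (\<lambda>e. case_nat (L (e 0) (\<lambda>i. e (Suc i))) (\<lambda>i. e (Suc i)) i)" for i
      by (intro prim_rec_fun_case_nat prim_rec_fun_pred prim_rec_fun_var L)
    with L show "prim_rec_fun (\<lambda>_. 0) (\<lambda>e. G (e 0) (\<lambda>i. e (Suc i)))"
      unfolding G_def
      by (intro prim_rec_fun_if prim_rec_pred_conj prim_rec_pred_less prim_rec_pred_eq
          prim_rec_fun_Suc prim_rec_fun_var prim_rec_fun_const fuel_evaluator_compose[OF p])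
  next
    show "G t e = Suc y" if "G s e = Suc y" "s \<le> t" for e s t y
    proof -
      have "y < t \<and> F t (case_nat y e) = Suc 0"
        using that fuel_evaluator_mono[OF p, OF _ that(2)] unfolding G One_nat_def by auto
      moreover have "\<exists>v. F t (case_nat k e) = Suc (Suc v)" if "k < y" for k
        using \<open>G s e = Suc y\<close> \<open>k < y\<close> fuel_evaluator_mono[OF p, OF _ \<open>s \<le> t\<close>] unfolding G by blast
      ultimately show ?thesis unfolding G One_nat_def by blast
    qed
  next
    fix e y
    assume "computes (\<lambda>_. 0) (Mu p) (map e [0..<n]) y"
    then have y: "computes (\<lambda>_. 0) p (y # map e [0..<n]) 0"
      and "\<And>m. m < y \<Longrightarrow> \<exists>v. computes (\<lambda>_. 0) p (m # map e [0..<n]) (Suc v)"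
      by (auto elim: computes_elims)
    then obtain v where v: "\<And>m. m < y \<Longrightarrow> computes (\<lambda>_. 0) p (m # map e [0..<n]) (Suc (v m))"
      by metis
    have "\<exists>s. \<forall>t\<ge>s. \<forall>m<y. F t (case_nat m e) = Suc (Suc (v m))"
      by (rule fuel_evaluator_complete_all[where n = "\<lambda>_. Suc n" and p = "\<lambda>_. p" and F = "\<lambda>_. F"
            and e = "\<lambda>m. case_nat m e" and y = "\<lambda>m. Suc (v m)", OF p])
        (use v in \<open>simp only: map_case_nat_upt\<close>)
    then obtain s where s: "\<And>t m. t \<ge> s \<Longrightarrow> m < y \<Longrightarrow> F t (case_nat m e) = Suc (Suc (v m))"
      by blast
    have "\<exists>r. F r (case_nat y e) = Suc 0"
      by (rule fuel_evaluator_complete[OF p]) (use y in \<open>simp only: map_case_nat_upt\<close>)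
    then obtain r where r: "F r (case_nat y e) = Suc 0" ..
    \<comment> \<open>The fuel covers the zero at \<open>y\<close> by \<open>r\<close>, the smaller
      arguments by \<open>s\<close>, and by \<open>Suc y\<close> it brings \<open>y\<close> within
      the search bound, which is the fuel itself.\<close>
    have "F (r + s + Suc y) (case_nat y e) = Suc 0"
      by (rule fuel_evaluator_mono[OF p, OF r]) simp
    moreover have "F (r + s + Suc y) (case_nat m e) = Suc (Suc (v m))" if "m < y" for m
      using s[OF _ that] by simp
    ultimately have "G (r + s + Suc y) e = Suc y" unfolding G One_nat_def by auto
    then show "\<exists>s. G s e = Suc y" ..
  qed
  then show ?thesis by blast
qed

lemma ex_fuel_evaluator: "oracle_free p \<Longrightarrow> \<exists>F. fuel_evaluator n p F"
proof (induction p arbitrary: n)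
  case Zero
  have "fuel_evaluator n Zero (\<lambda>s e. Suc 0)"
    by (rule fuel_evaluatorI)
      (intro prim_rec_fun_Suc prim_rec_fun_var prim_rec_fun_const, auto elim: computes_elims)
  then show ?case by blast
next
  case Succ
  \<comment> \<open>Nothing is asked of an evaluator where the program gets stuck, so for arities
    other than 1 this value is as good as any.\<close>
  have "fuel_evaluator n Succ (\<lambda>s e. Suc (Suc (e 0)))"
  proof (rule fuel_evaluatorI)
    fix e y assume "computes (\<lambda>_. 0) Succ (map e [0..<n]) y"
    then have "map e [0..<n] = [y - 1] \<and> y > 0" by (auto elim: computes_elims)
    then show "\<exists>s. Suc (Suc (e 0)) = Suc y"
      by (cases n; cases "n - 1") (auto simp: map_upt_Suc simp del: upt_Suc)
  qed (simp_all, intro prim_rec_fun_Suc prim_rec_fun_var)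
  then show ?case by blast
next
  case (Proj k)
  have "fuel_evaluator n (Proj k) (\<lambda>s e. Suc (e k))"
    by (rule fuel_evaluatorI)
      (intro prim_rec_fun_Suc prim_rec_fun_var prim_rec_fun_const, auto elim: computes_elims)
  then show ?case by blast
next
  case Oracle
  then show ?case by simp
next
  case (Comp p qs)
  then have "\<forall>i<length qs. \<exists>H. fuel_evaluator n (qs ! i) H" by simp
  then obtain H where "\<And>i. i < length qs \<Longrightarrow> fuel_evaluator n (qs ! i) (H i)" by metis
  with Comp show ?case using ex_fuel_evaluator_Comp by (metis oracle_free.simps(2))
next
  case (PrimRec p q)
  show ?case
  proof (cases n)
    case 0
    \<comment> \<open>Without a recursion argument the program is stuck and completeness holds
      vacuously.\<close>
    have "fuel_evaluator n (PrimRec p q) (\<lambda>s e. 0)"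
      unfolding 0 by (rule fuel_evaluatorI)
      (intro prim_rec_fun_Suc prim_rec_fun_var prim_rec_fun_const, auto elim: computes_elims)
    then show ?thesis by blast
  next
    case (Suc n)
    with PrimRec ex_fuel_evaluator_PrimRec show ?thesis by (metis oracle_free.simps(3))
  qed
next
  case (Mu p)
  then show ?case using ex_fuel_evaluator_Mu by (metis oracle_free.simps(4))
qed


subsection \<open>Counting the elements of a set\<close>

definition count_below :: "nat set \<Rightarrow> nat \<Rightarrow> nat" where
  "count_below S n = card {m \<in> S. m < n}"

text \<open>For infinite \<open>S\<close> this is the increasing enumeration. It need not be
  primitive recursive even if \<open>S\<close> is, whereas its inverse \<open>count_below S\<close>
  then is; statements about the \<open>i\<close>-th element are therefore phrased by
  counting.\<close>

definition nth_element :: "nat set \<Rightarrow> nat \<Rightarrow> nat" where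
  "nth_element S = inv_into S (count_below S)"

lemma count_below_0: "count_below S 0 = 0"
  by (simp add: count_below_def)

lemma count_below_Suc:
  "count_below S (Suc n) = (if n \<in> S then Suc (count_below S n) else count_below S n)"
proof -
  have "{m \<in> S. m < Suc n} = (if n \<in> S then insert n {m \<in> S. m < n} else {m \<in> S. m < n})"
    by (auto simp: less_Suc_eq)
  then show ?thesis by (simp add: count_below_def)
qed

lemma count_below_mono: "m \<le> n \<Longrightarrow> count_below S m \<le> count_below S n"
  unfolding count_below_def by (rule card_mono) auto

lemma count_below_strict_mono: "m < n \<Longrightarrow> m \<in> S \<Longrightarrow> count_below S m < count_below S n"
  using count_below_mono[of "Suc m" n S] by (simp add: count_below_Suc)

lemma inj_on_count_below: "inj_on (count_below S) S"
  by (rule inj_onI) (metis count_below_strict_mono less_irrefl linorder_neqE_nat)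

lemma count_below_attains: "k < count_below S b \<Longrightarrow> \<exists>n<b. n \<in> S \<and> count_below S n = k"
  by (induction b) (force simp: count_below_0 count_below_Suc less_Suc_eq split: if_splits)+

lemma count_below_unbounded:
  assumes "infinite S" shows "\<exists>n. k < count_below S n"
proof (rule ccontr)
  assume "\<not> ?thesis"
  then have k: "count_below S n \<le> k" for n by (simp add: not_less)
  obtain X where X: "X \<subseteq> S" "finite X" "card X = Suc k"
    using assms infinite_arbitrarily_large by blast
  have "X \<subseteq> {m \<in> S. m < Suc (Max X)}" using X by (auto simp: less_Suc_eq_le)
  then have "card X \<le> count_below S (Suc (Max X))"
    unfolding count_below_def by (intro card_mono) auto
  with k[of "Suc (Max X)"] X(3) show False by simp
qed

lemma nth_element:
  assumes "infinite S"
  shows nth_element_in: "nth_element S k \<in> S"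
    and count_below_nth_element: "count_below S (nth_element S k) = k"
proof -
  have "k \<in> count_below S ` S"
    using count_below_unbounded[OF assms, of k] count_below_attains by blast
  then show "nth_element S k \<in> S" "count_below S (nth_element S k) = k"
    unfolding nth_element_def by (rule inv_into_into, rule f_inv_into_f)
qed

lemma nth_element_count_below: "v \<in> S \<Longrightarrow> nth_element S (count_below S v) = v"
  unfolding nth_element_def by (rule inv_into_f_f[OF inj_on_count_below])

lemma inj_nth_element: "infinite S \<Longrightarrow> inj (nth_element S)"
  by (metis count_below_nth_element injI)

lemma range_nth_element: "infinite S \<Longrightarrow> range (nth_element S) = S"
  by (metis nth_element_in nth_element_count_below image_subset_iff rangeI subsetI subset_antisym)

lemma prim_rec_fun_count_below:
  assumes S: "prim_rec_pred g (\<lambda>e. e 0 \<in> S)" and t: "prim_rec_fun g t"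
  shows "prim_rec_fun g (\<lambda>e. count_below S (t e))"
proof -
  have "prim_rec_fun g (\<lambda>e. rec_nat 0 (\<lambda>k r. if k \<in> S then Suc r else r) (t e))"
    by (intro prim_rec_fun_rec prim_rec_fun_if prim_rec_fun_Suc prim_rec_fun_var
        prim_rec_fun_const S t)
  moreover have "rec_nat 0 (\<lambda>k r. if k \<in> S then Suc r else r) n = count_below S n" for n
    by (induction n) (simp_all add: count_below_0 count_below_Suc)
  ultimately show ?thesis by simp
qed


subsection \<open>Delayed copies\<close>

text \<open>
  A copy of \<open>T\<close> in which the elements \<open>y 0, y 1, \<dots>\<close> appear without delay, while every other
  element \<open>z\<close> is held back until the witnesses demanded by \<open>W\<close> have been found for all
  \<open>x \<le> z\<close>. Such a copy is punctual provided that the relation between a delayed \<open>z\<close> and \<open>y i\<close>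
  is primitive recursive in \<open>z\<close>, \<open>i\<close> and a witness for \<open>z\<close>.
\<close>

locale delayed_copy =
  fixes T :: "nat rel" and y :: "nat \<Rightarrow> nat" and W M :: "nat \<Rightarrow> nat \<Rightarrow> bool"
    and P P' :: "nat \<Rightarrow> nat \<Rightarrow> nat \<Rightarrow> bool" and Q :: "nat \<Rightarrow> nat \<Rightarrow> bool"
  assumes inj_y: "inj y"
    and W_ex: "\<exists>s. W z s"
    and W_mono: "W z s \<Longrightarrow> s \<le> t \<Longrightarrow> W z t"
    and M: "W z s \<Longrightarrow> M z s \<longleftrightarrow> z \<in> range y"
    and P: "W z s \<Longrightarrow> z \<notin> range y \<Longrightarrow> P z s i \<longleftrightarrow> (z, y i) \<in> T"
    and P': "W z s \<Longrightarrow> z \<notin> range y \<Longrightarrow> P' z s i \<longleftrightarrow> (y i, z) \<in> T"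
    and Q: "Q i j \<longleftrightarrow> (y i, y j) \<in> T"
    and pr_T: "prim_rec_pred (\<lambda>_. 0) (\<lambda>e. (e 0, e (Suc 0)) \<in> T)"
    and pr_W: "prim_rec_pred (\<lambda>_. 0) (\<lambda>e. W (e 0) (e (Suc 0)))"
    and pr_M: "prim_rec_pred (\<lambda>_. 0) (\<lambda>e. M (e 0) (e (Suc 0)))"
    and pr_P: "prim_rec_pred (\<lambda>_. 0) (\<lambda>e. P (e 0) (e (Suc 0)) (e (Suc (Suc 0))))"
    and pr_P': "prim_rec_pred (\<lambda>_. 0) (\<lambda>e. P' (e 0) (e (Suc 0)) (e (Suc (Suc 0))))"
    and pr_Q: "prim_rec_pred (\<lambda>_. 0) (\<lambda>e. Q (e 0) (e (Suc 0)))"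
begin

definition delay :: "nat \<Rightarrow> nat" where
  "delay z = (LEAST s. \<forall>x<Suc z. W x s)"

text \<open>A delayed \<open>z\<close> gets position \<open>z + z + delay z\<close>. The witness is
  an explicit argument and its minimality is tested by bounded quantifiers because
  \<open>delay\<close> need not be primitive recursive, while \<open>s\<close> is bounded by the
  position \<open>n\<close>.\<close>

definition slow :: "nat \<Rightarrow> nat \<Rightarrow> nat \<Rightarrow> bool" where
  "slow n z s \<longleftrightarrow> n = z + z + s \<and> (\<forall>x<Suc z. W x s) \<and> (\<forall>r<s. \<exists>x<Suc z. \<not> W x r) \<and> \<not> M z s"

definition fast :: "nat set" where
  "fast = {n. \<not> (\<exists>z<Suc n. \<exists>s<Suc n. slow n z s)}"

definition label :: "nat \<Rightarrow> nat" where
  "label n = (if n \<in> fast then y (count_below fast n) else (THE z. \<exists>s. slow n z s))"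

definition copy :: "nat rel" where
  "copy = {(m, n). (label m, label n) \<in> T}"

lemma W_delay: "x \<le> z \<Longrightarrow> W x (delay z)"
proof -
  have "\<exists>s. \<forall>x<Suc z. W x s"
  proof (induction z)
    case 0
    then show ?case using W_ex by simp
  next
    case (Suc z)
    then obtain s t where "\<forall>x<Suc z. W x s" "W (Suc z) t" using W_ex by blast
    then have "\<forall>x<Suc (Suc z). W x (max s t)"
      using W_mono by (metis less_Suc_eq max.cobounded1 max.cobounded2)
    then show ?case ..
  qed
  then have "\<forall>x<Suc z. W x (delay z)" unfolding delay_def by (rule LeastI_ex)
  then show "x \<le> z \<Longrightarrow> W x (delay z)" by simp
qed

lemma delay_mono: "z \<le> z' \<Longrightarrow> delay z \<le> delay z'"
  using W_delay[of _ z'] unfolding delay_def[of z] by (intro Least_le) simp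

lemma slow_iff: "slow n z s \<longleftrightarrow> s = delay z \<and> n = z + z + delay z \<and> z \<notin> range y"
proof -
  have "(\<forall>x<Suc z. W x s) \<and> (\<forall>r<s. \<exists>x<Suc z. \<not> W x r) \<longleftrightarrow> s = delay z"
  proof
    assume s: "(\<forall>x<Suc z. W x s) \<and> (\<forall>r<s. \<exists>x<Suc z. \<not> W x r)"
    then have "s \<le> r" if "\<forall>x<Suc z. W x r" for r
      using that by (blast intro: leI)
    with s show "s = delay z"
      unfolding delay_def by (intro Least_equality[symmetric]) blast+
  next
    assume s: "s = delay z"
    have "\<exists>x<Suc z. \<not> W x r" if "r < delay z" for r
      using not_less_Least[OF that[unfolded delay_def]] by blast
    then show "(\<forall>x<Suc z. W x s) \<and> (\<forall>r<s. \<exists>x<Suc z. \<not> W x r)"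
      using W_delay s by simp
  qed
  moreover have "M z (delay z) \<longleftrightarrow> z \<in> range y" by (rule M[OF W_delay]) simp
  ultimately show ?thesis unfolding slow_def by auto
qed

text \<open>As \<open>delay\<close> is monotone, the summand \<open>z + z\<close> alone keeps
  delayed positions more than one apart. Hence one of \<open>2 * k\<close> and
  \<open>2 * k + 1\<close> is always free for the next \<open>y\<close>.\<close>

lemma slow_gap: "slow n z s \<Longrightarrow> slow n' z' s' \<Longrightarrow> z < z' \<Longrightarrow> Suc n < n'"
  using delay_mono[of z z'] by (auto simp: slow_iff)

lemma slow_unique: "slow n z s \<Longrightarrow> slow n z' s' \<Longrightarrow> z = z'"
  using slow_gap[of n z s n z' s'] slow_gap[of n z' s' n z s] by (cases z z' rule: linorder_cases) auto

lemma fast_iff: "n \<in> fast \<longleftrightarrow> (\<forall>z s. \<not> slow n z s)"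
proof -
  have "z < Suc n" "s < Suc n" if "slow n z s" for z s
    using that by (auto simp: slow_iff)
  then show ?thesis unfolding fast_def by blast
qed

lemma fast_or_slow: "n \<in> fast \<or> (\<exists>z s. slow n z s)"
  unfolding fast_iff by blast

lemma label_slow: "slow n z s \<Longrightarrow> label n = z"
  using slow_unique by (auto simp: label_def fast_iff)

lemma label_fast: "n \<in> fast \<Longrightarrow> label n = y (count_below fast n)"
  by (simp add: label_def)

lemma count_fast: "k \<le> count_below fast (2 * k)"
proof (induction k)
  case (Suc k)
  have "2 * k \<in> fast \<or> Suc (2 * k) \<in> fast"
  proof (rule ccontr)
    assume "\<not> ?thesis"
    then obtain z s z' s' where s: "slow (2 * k) z s" "slow (Suc (2 * k)) z' s'"
      by (auto simp: fast_iff)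
    show False
      using slow_gap[OF s] slow_gap[OF s(2,1)] s unfolding slow_iff
      by (cases z z' rule: linorder_cases) auto
  qed
  then show ?case using Suc by (auto simp: count_below_Suc)
qed simp

lemma label_attains_y: "\<exists>n\<le>2 * k + 1. label n = y k"
proof -
  obtain n where "n < 2 * Suc k" "n \<in> fast" "count_below fast n = k"
    using count_below_attains[of k fast "2 * Suc k"] count_fast[of "Suc k"] by auto
  then show ?thesis using label_fast by (intro exI[of _ n]) auto
qed

text \<open>A delayed node sits at a position no smaller than its delay, so the position is itself a
  witness for all arguments up to the node. This turns positions into fuel.\<close>

lemma label_slow_position: "label n \<notin> range y \<Longrightarrow> x \<le> label n \<Longrightarrow> W x n"
proof -
  assume l: "label n \<notin> range y" and x: "x \<le> label n"
  then have "n \<notin> fast" using label_fast by auto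
  then obtain z s where s: "slow n z s" by (auto simp: fast_iff)
  then have "W x (delay z)" using x label_slow by (intro W_delay) simp
  then show "W x n" using W_mono s by (simp add: slow_iff)
qed

lemma bij_label: "bij label"
proof (rule bijI)
  show "inj label"
  proof (rule injI)
    fix m n assume eq: "label m = label n"
    consider "m \<in> fast" "n \<in> fast" | z s where "m \<in> fast" "slow n z s"
      | z s where "n \<in> fast" "slow m z s" | z s z' s' where "slow m z s" "slow n z' s'"
      using fast_or_slow[of m] fast_or_slow[of n] by blast
    then show "m = n"
    proof cases
      case 1
      then have "count_below fast m = count_below fast n"
        using eq by (simp add: label_fast inj_eq[OF inj_y])
      from inj_onD[OF inj_on_count_below this 1] show ?thesis .
    next
      case 2
      then show ?thesis using eq label_slow[of n z s] by (auto simp: label_fast slow_iff)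
    next
      case 3
      then show ?thesis using eq label_slow[of m z s] by (auto simp: label_fast slow_iff)
    next
      case 4
      then have "z = z'" using eq label_slow[OF 4(1)] label_slow[OF 4(2)] by simp
      with 4 show ?thesis by (simp add: slow_iff)
    qed
  qed
  have "\<exists>n. label n = z" for z
  proof (cases "z \<in> range y")
    case True
    then show ?thesis using label_attains_y by (metis rangeE)
  next
    case False
    then have "slow (z + z + delay z) z (delay z)" by (simp add: slow_iff)
    then show ?thesis using label_slow by blast
  qed
  then show "surj label" by (metis surjI)
qed

lemma isomorphism_label: "isomorphism copy T label"
  by (simp add: isomorphism_def bij_label copy_def)

text \<open>The definition of \<open>copy\<close> goes through \<open>label\<close>, which need not
  be primitive recursive on \<open>fast\<close>. Here \<open>T\<close> is applied only to two
  delayed nodes, which are bounded by their positions; all relations with some \<open>y i\<close> go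
  through \<open>P\<close>, \<open>P'\<close> and \<open>Q\<close>.\<close>

lemma copy_iff: "(m, n) \<in> copy \<longleftrightarrow>
    (\<exists>z<Suc m. \<exists>s<Suc m. slow m z s \<and>
      ((\<exists>z'<Suc n. \<exists>s'<Suc n. slow n z' s' \<and> (z, z') \<in> T)
       \<or> n \<in> fast \<and> P z s (count_below fast n)))
    \<or> m \<in> fast \<and>
      ((\<exists>z'<Suc n. \<exists>s'<Suc n. slow n z' s' \<and> P' z' s' (count_below fast m))
       \<or> n \<in> fast \<and> Q (count_below fast m) (count_below fast n))"
proof -
  have bound: "(\<exists>z<Suc n. \<exists>s<Suc n. slow n z s \<and> R z s) \<longleftrightarrow> (\<exists>z s. slow n z s \<and> R z s)" for n R
  proof -
    have "z < Suc n" "s < Suc n" if "slow n z s" for z s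
      using that by (auto simp: slow_iff)
    then show ?thesis by blast
  qed
  have sW: "W z s" "z \<notin> range y" if "slow n z s" for n z s
    using that W_delay[of z z] by (auto simp: slow_iff)
  have fast_slow: False if "slow n z s" "n \<in> fast" for n z s using that by (simp add: fast_iff)
  consider "m \<in> fast" "n \<in> fast" | z s where "m \<in> fast" "slow n z s"
    | z s where "n \<in> fast" "slow m z s" | z s z' s' where "slow m z s" "slow n z' s'"
    using fast_or_slow[of m] fast_or_slow[of n] by blast
  then show ?thesis
  proof cases
    case 1
    then show ?thesis unfolding bound by (auto simp: copy_def label_fast Q dest: fast_slow)
  next
    case 2
    have "P' z' s' i \<longleftrightarrow> (y i, z) \<in> T" if "slow n z' s'" for z' s' i
      using P'[OF sW[OF that]] slow_unique[OF that 2(2)] by simp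
    with 2 show ?thesis unfolding bound
      by (auto simp: copy_def label_fast label_slow[OF 2(2)] dest: fast_slow)
  next
    case 3
    have "P z' s' i \<longleftrightarrow> (z, y i) \<in> T" if "slow m z' s'" for z' s' i
      using P[OF sW[OF that]] slow_unique[OF that 3(2)] by simp
    with 3 show ?thesis unfolding bound
      by (auto simp: copy_def label_fast label_slow[OF 3(2)] dest: fast_slow)
  next
    case 4
    then show ?thesis unfolding bound
      by (auto simp: copy_def label_slow[OF 4(1)] label_slow[OF 4(2)]
          dest: fast_slow slow_unique[OF _ 4(1)] slow_unique[OF _ 4(2)])
  qed
qed

lemma punctual_copy: "punctual copy"
proof -
  note rules = prim_rec_intros prim_rec_pred_comp2[OF pr_T] prim_rec_pred_comp2[OF pr_W]
    prim_rec_pred_comp2[OF pr_M] prim_rec_pred_comp3[OF pr_P] prim_rec_pred_comp3[OF pr_P']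
    prim_rec_pred_comp2[OF pr_Q]
  have "prim_rec_pred (\<lambda>_. 0) (\<lambda>e. slow (e 0) (e (Suc 0)) (e (Suc (Suc 0))))"
    unfolding slow_def by (intro rules)
  note slow = prim_rec_pred_comp3[OF this]
  have fast: "prim_rec_pred (\<lambda>_. 0) (\<lambda>e. e 0 \<in> fast)"
    unfolding fast_def mem_Collect_eq by (intro rules slow)
  note fast' = prim_rec_pred_comp1[OF fast] prim_rec_fun_count_below[OF fast]
  show ?thesis
    unfolding punctual_def prim_rec_rel_iff copy_iff by (intro rules slow fast')
qed

end


subsection \<open>Isomorphisms and degrees\<close>

lemma isomorphism_inv: "isomorphism A B f \<Longrightarrow> isomorphism B A (inv f)"
  unfolding isomorphism_def by (metis bij_imp_bij_inv bij_inv_eq_iff)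

lemma isomorphism_comp: "isomorphism A B f \<Longrightarrow> isomorphism B C g \<Longrightarrow> isomorphism A C (g \<circ> f)"
  unfolding isomorphism_def by (auto intro: bij_comp)

text \<open>Degrees are equivalence classes, so a reduction to one member yields a reduction to
  every member. This lets two isomorphisms be computed from one common oracle.\<close>

lemma pr_le_degree_member:
  assumes "d \<in> pr_degrees" "f \<le>PRdeg d" "g \<in> d"
  shows "f \<le>PR g"
proof -
  obtain x where x: "d = pr_equiv `` {x}" using assms(1) unfolding pr_degrees_def by (rule quotientE)
  obtain h where "h \<in> d" "f \<le>PR h" using assms(2) unfolding pr_le_degree_def by blast
  moreover have "h \<le>PR x" "x \<le>PR g" using \<open>h \<in> d\<close> assms(3) by (auto simp: x pr_equiv_def)
  ultimately show ?thesis using pr_le_trans by blast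
qed


subsection \<open>Punctual trees\<close>

locale punctual_tree =
  fixes T :: "nat rel"
  assumes punctual: "punctual T" and tree: "is_tree T"
begin

abbreviation le :: "nat \<Rightarrow> nat \<Rightarrow> bool"  (infix "\<preceq>" 50) where
  "x \<preceq> y \<equiv> (x, y) \<in> T"

abbreviation comparable :: "nat \<Rightarrow> nat \<Rightarrow> bool"  (infix "\<sim>" 50) where
  "x \<sim> y \<equiv> x \<preceq> y \<or> y \<preceq> x"

definition above :: "nat \<Rightarrow> nat \<Rightarrow> bool" where
  "above a x \<longleftrightarrow> a \<preceq> x \<and> a \<noteq> x"

lemma le_refl: "x \<preceq> x"
  using tree unfolding is_tree_def partial_order_on_def preorder_on_def refl_on_def by simp

lemma le_trans: "x \<preceq> y \<Longrightarrow> y \<preceq> z \<Longrightarrow> x \<preceq> z"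
  using tree unfolding is_tree_def partial_order_on_def preorder_on_def by (meson transD)

lemma le_antisym: "x \<preceq> y \<Longrightarrow> y \<preceq> x \<Longrightarrow> x = y"
  using tree unfolding is_tree_def partial_order_on_def by (meson antisymD)

lemma comparable_below: "x \<preceq> z \<Longrightarrow> y \<preceq> z \<Longrightarrow> x \<sim> y"
proof -
  assume xy: "x \<preceq> z" "y \<preceq> z"
  have "total_on (predecessors T z) (Restr T (predecessors T z))"
    using tree unfolding is_tree_def linear_order_on_def by blast
  then show ?thesis
    using xy le_refl unfolding total_on_def predecessors_def by (cases "x = y") blast+
qed

lemma above_trans: "above a x \<Longrightarrow> x \<preceq> y \<Longrightarrow> above a y"
  unfolding above_def using le_trans le_antisym by metis

lemma not_le_above: "above a x \<Longrightarrow> \<not> x \<preceq> a"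
  unfolding above_def using le_antisym by blast

text \<open>The number of predecessors is the depth of a node. It serves as a rank: automorphisms
  preserve it, and minimal depth above \<open>a\<close> singles out immediate successors.\<close>

lemma card_predecessors_less:
  assumes "above x y" shows "card (predecessors T x) < card (predecessors T y)"
proof (rule psubset_card_mono)
  show "finite (predecessors T y)" using tree unfolding is_tree_def by blast
  have "predecessors T x \<subseteq> predecessors T y"
    using assms le_trans le_antisym unfolding predecessors_def above_def by blast
  moreover have "x \<in> predecessors T y" "x \<notin> predecessors T x"
    using assms unfolding predecessors_def above_def by auto
  ultimately show "predecessors T x \<subset> predecessors T y" by blast
qed

lemma card_predecessors_automorphism:
  assumes "isomorphism T T \<psi>"
  shows "card (predecessors T (\<psi> x)) = card (predecessors T x)"
proof -
  have \<psi>: "bij \<psi>" "\<And>u v. \<psi> u \<preceq> \<psi> v \<longleftrightarrow> u \<preceq> v" using assms unfolding isomorphism_def by auto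
  have "predecessors T (\<psi> x) = \<psi> ` predecessors T x"
  proof
    show "predecessors T (\<psi> x) \<subseteq> \<psi> ` predecessors T x"
    proof
      fix v assume v: "v \<in> predecessors T (\<psi> x)"
      obtain u where "v = \<psi> u" using \<psi>(1) by (metis bij_pointE)
      with v show "v \<in> \<psi> ` predecessors T x" by (auto simp: predecessors_def \<psi>(2))
    qed
    show "\<psi> ` predecessors T x \<subseteq> predecessors T (\<psi> x)"
      using bij_is_inj[OF \<psi>(1)] by (auto simp: predecessors_def \<psi>(2) inj_eq)
  qed
  then show ?thesis
    using card_image[OF inj_on_subset[OF bij_is_inj[OF \<psi>(1)] subset_UNIV]] by simp
qed

lemma immediate_succs_iff: "c \<in> immediate_succs T a \<longleftrightarrow> above a c \<and> (\<forall>x. above a x \<longrightarrow> \<not> above x c)"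
  unfolding immediate_succs_def above_def by auto

lemma immediate_succs_comparable:
  assumes "c \<in> immediate_succs T a" "above a x" "x \<sim> c"
  shows "c \<preceq> x"
  using assms le_refl unfolding immediate_succs_iff above_def by blast

lemma immediate_succs_below_unique:
  assumes "c \<in> immediate_succs T a" "c' \<in> immediate_succs T a" "c \<preceq> x" "c' \<preceq> x"
  shows "c = c'"
  using assms immediate_succs_comparable comparable_below le_antisym
  unfolding immediate_succs_iff by metis

lemma ex_immediate_succ_below:
  assumes "above a z" shows "\<exists>c \<in> immediate_succs T a. c \<preceq> z"
proof -
  obtain c where c: "above a c" "c \<preceq> z"
    and least: "\<And>x. above a x \<Longrightarrow> x \<preceq> z \<Longrightarrow> card (predecessors T c) \<le> card (predecessors T x)"
    using ex_has_least_nat[of "\<lambda>x. above a x \<and> x \<preceq> z" z "\<lambda>x. card (predecessors T x)"]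
      assms le_refl by blast
  have "\<not> above x c" if "above a x" for x
    using least[OF that] card_predecessors_less[of x c] c(2) le_trans by (metis above_def not_less)
  with c show ?thesis by (intro bexI[of _ c]) (simp_all add: immediate_succs_iff)
qed

lemma pr_T: "prim_rec_pred (\<lambda>_. 0) (\<lambda>e. e 0 \<preceq> e (Suc 0))"
  using punctual unfolding punctual_def prim_rec_rel_iff .

lemma pr_above:
  "prim_rec_fun (\<lambda>_. 0) t \<Longrightarrow> prim_rec_fun (\<lambda>_. 0) u \<Longrightarrow>
    prim_rec_pred (\<lambda>_. 0) (\<lambda>e. above (t e) (u e))"
  unfolding above_def by (intro prim_rec_intros prim_rec_pred_comp2[OF pr_T])

lemmas tree_intros = prim_rec_intros prim_rec_pred_comp2[OF pr_T] pr_above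


subsection \<open>Fresh nodes\<close>

text \<open>
  Being an immediate successor of \<open>a\<close> is not decidable; \<open>fresh a\<close> is a decidable substitute. It
  contains the numerically least node of each subtree that is rooted at a child of \<open>a\<close>.
\<close>

definition fresh :: "nat \<Rightarrow> nat set" where
  "fresh a = {y. above a y \<and> (\<forall>z<y. z \<preceq> a \<or> \<not> z \<sim> y)}"

lemma fresh_above: "y \<in> fresh a \<Longrightarrow> above a y"
  by (simp add: fresh_def)

lemma fresh_smaller: "y \<in> fresh a \<Longrightarrow> z < y \<Longrightarrow> z \<sim> y \<Longrightarrow> z \<preceq> a"
  unfolding fresh_def by blast

text \<open>Of two distinct comparable fresh nodes, the numerically larger one would force the
  smaller to lie at or below \<open>a\<close>.\<close>

lemma fresh_antichain: "x \<in> fresh a \<Longrightarrow> y \<in> fresh a \<Longrightarrow> x \<sim> y \<Longrightarrow> x = y"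
  using fresh_smaller[of y a x] fresh_smaller[of x a y] not_le_above fresh_above
  by (metis linorder_neqE_nat)

lemma infinite_fresh:
  assumes "infinite (immediate_succs T a)" shows "infinite (fresh a)"
proof -
  define m where "m c = (LEAST x. c \<preceq> x)" for c
  have m: "c \<preceq> m c" for c unfolding m_def by (rule LeastI[of "\<lambda>x. c \<preceq> x"]) (rule le_refl)
  have m_least: "\<not> c \<preceq> z" if "z < m c" for c z
    using not_less_Least that unfolding m_def by blast
  have "m c \<in> fresh a" if c: "c \<in> immediate_succs T a" for c
  proof -
    have "z \<preceq> a" if z: "z < m c" "z \<sim> m c" for z
    proof -
      \<comment> \<open>By minimality \<open>z\<close> is outside the subtree rooted at
        \<open>c\<close>. Being comparable with a node of it, \<open>z\<close> lies below
        \<open>c\<close>, hence at or below \<open>a\<close>, as nothing is strictly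
        between.\<close>
      have "\<not> c \<preceq> z" using m_least[OF z(1)] .
      then have "z \<preceq> m c" using z(2) le_trans m by blast
      then have "z \<sim> c" using m comparable_below by blast
      then have zc: "z \<preceq> c" using \<open>\<not> c \<preceq> z\<close> by blast
      moreover have "a \<preceq> c" using c unfolding immediate_succs_iff above_def by blast
      ultimately have "z \<sim> a" by (rule comparable_below)
      moreover have "\<not> above a z"
        using immediate_succs_comparable[OF c] zc \<open>\<not> c \<preceq> z\<close> by blast
      ultimately show ?thesis using le_refl unfolding above_def by blast
    qed
    moreover have "above a (m c)"
      using above_trans m c unfolding immediate_succs_iff by blast
    ultimately show ?thesis unfolding fresh_def by blast
  qed
  then have "m ` immediate_succs T a \<subseteq> fresh a" by blast
  moreover have "inj_on m (immediate_succs T a)"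
    by (rule inj_onI) (metis m immediate_succs_below_unique)
  ultimately show ?thesis using assms by (meson finite_imageD finite_subset)
qed

lemma pr_fresh: "prim_rec_pred (\<lambda>_. 0) (\<lambda>e. e 0 \<in> fresh a)"
  unfolding fresh_def mem_Collect_eq by (intro tree_intros)

text \<open>A fresh node numerically larger than \<open>z\<close> is comparable with
  \<open>z\<close> only if \<open>z \<preceq> a\<close>, so it suffices to inspect
  \<open>v < z\<close>. This bounded form makes the relations with the enumerated nodes primitive
  recursive when \<open>S\<close> is.\<close>

lemma nth_fresh:
  assumes S: "S \<subseteq> fresh a" "infinite S" and z: "z \<notin> S"
  shows "z \<preceq> nth_element S i \<longleftrightarrow>
      z \<preceq> a \<or> (\<exists>v<z. v \<in> S \<and> count_below S v = i \<and> z \<preceq> v)" (is ?A)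
    and "nth_element S i \<preceq> z \<longleftrightarrow>
      (\<exists>v<z. v \<in> S \<and> count_below S v = i \<and> v \<preceq> z)" (is ?B)
proof -
  define v where "v = nth_element S i"
  have v: "v \<in> S" "count_below S v = i"
    using nth_element[OF S(2)] by (simp_all add: v_def)
  have v_unique: "u = v" if "u \<in> S" "count_below S u = i" for u
    using nth_element_count_below[OF that(1)] that(2) by (simp add: v_def)
  have fresh: "v \<in> fresh a" using v S by blast
  have "v \<noteq> z" using v z by blast
  have smaller: "z \<preceq> a" if "z \<sim> v" "\<not> v < z"
    using fresh_smaller[OF fresh _ that(1)] that(2) \<open>v \<noteq> z\<close> by simp
  have "z \<preceq> v" if "z \<preceq> a" using le_trans[OF that] fresh_above[OF fresh] by (simp add: above_def)
  then show ?A unfolding v_def[symmetric] using v v_unique smaller by blast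
  have "\<not> v \<preceq> z" if "z \<preceq> a" using that le_trans not_le_above[OF fresh_above[OF fresh]] by blast
  then show ?B unfolding v_def[symmetric] using v v_unique smaller by blast
qed

text \<open>Later \<open>W x s\<close> will say that the computation of \<open>f x\<close> halts
  with fuel \<open>s\<close>.\<close>

lemma antichain_copy:
  assumes a: "infinite (immediate_succs T a)"
    and W: "\<And>z. \<exists>s. W z s" "\<And>z s t. W z s \<Longrightarrow> s \<le> t \<Longrightarrow> W z t"
    and pr_W: "prim_rec_pred (\<lambda>_. 0) (\<lambda>e. W (e 0) (e (Suc 0)))"
  shows "\<exists>B g. punctual B \<and> isomorphism B T g \<and> (\<forall>n x. g n \<notin> fresh a \<longrightarrow> x \<le> g n \<longrightarrow> W x n)"
proof -
  note inf = infinite_fresh[OF a]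
  note rules = tree_intros prim_rec_pred_comp1[OF pr_fresh] prim_rec_fun_count_below[OF pr_fresh]
  interpret delayed_copy T "nth_element (fresh a)" W "\<lambda>z s. z \<in> fresh a"
    "\<lambda>z s i. z \<preceq> a \<or> (\<exists>v<z. v \<in> fresh a \<and> count_below (fresh a) v = i \<and> z \<preceq> v)"
    "\<lambda>z s i. \<exists>v<z. v \<in> fresh a \<and> count_below (fresh a) v = i \<and> v \<preceq> z" "\<lambda>i j. i = j"
  proof
    show "(i = j) = (nth_element (fresh a) i \<preceq> nth_element (fresh a) j)" for i j
      using fresh_antichain nth_element_in[OF inf] le_refl inj_eq[OF inj_nth_element[OF inf]] by blast
  qed (use nth_fresh[OF subset_refl inf] in \<open>simp_all add: inj_nth_element range_nth_element inf W pr_W\<close>,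
      (intro rules)+)
  show ?thesis
    using punctual_copy isomorphism_label label_slow_position range_nth_element[OF inf] by blast
qed

subsection \<open>Copies that escape the fresh nodes\<close>

text \<open>Indices are grouped into the pairs \<open>2 * j\<close> and \<open>2 * j + 1\<close>,
  and one member of each pair must escape. The exceptions up to \<open>C\<close> are harmless: the
  composite of \<open>\<psi>\<close> and \<open>y\<close> is injective, so they are finitely
  many.\<close>

definition escaping_copy :: "nat \<Rightarrow> nat rel \<Rightarrow> (nat \<Rightarrow> nat) \<Rightarrow> (nat \<Rightarrow> nat) \<Rightarrow> bool" where
  "escaping_copy a B g y \<longleftrightarrow> punctual B \<and> isomorphism B T g \<and> inj y
     \<and> (\<forall>k. \<exists>n\<le>2 * k + 1. g n = y k)
     \<and> (\<forall>\<psi>. isomorphism T T \<psi> \<longrightarrow>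
          (\<exists>C. \<forall>j. \<exists>i. i div 2 = j \<and> (\<psi> (y i) \<notin> fresh a \<or> \<psi> (y i) \<le> C)))"

text \<open>The image of \<open>c\<close> lies below that of \<open>x\<close> in the tree but not at
  or below \<open>a\<close>; this prevents the image of \<open>x\<close> from being fresh once it is
  numerically larger.\<close>

lemma escape_fresh:
  assumes \<psi>: "isomorphism T T \<psi>" and c: "\<not> \<psi> c \<preceq> a" and x: "above c x"
  shows "\<psi> x \<notin> fresh a \<or> \<psi> x \<le> \<psi> c"
proof -
  have "\<psi> c \<preceq> \<psi> x" using \<psi> x unfolding isomorphism_def above_def by blast
  then show ?thesis using fresh_smaller[of "\<psi> x" a "\<psi> c"] c by (meson not_less)
qed

text \<open>Automorphisms preserve depth, so the image of \<open>c\<close> is too deep to lie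
  strictly below \<open>a\<close>.\<close>

lemma automorphism_not_le:
  assumes \<psi>: "isomorphism T T \<psi>" and c: "card (predecessors T a) \<le> card (predecessors T c)"
    and "\<psi> c \<noteq> a"
  shows "\<not> \<psi> c \<preceq> a"
  using card_predecessors_less[of "\<psi> c" a] card_predecessors_automorphism[OF \<psi>] assms
  unfolding above_def by (metis not_less)

section \<open>Two nodes with infinitely many immediate successors\<close>

lemma escaping_copy_two_infinite:
  assumes a: "infinite (immediate_succs T a)" and b: "infinite (immediate_succs T b)"
    and "a \<noteq> b" and ab: "card (predecessors T a) \<le> card (predecessors T b)"
  shows "\<exists>B g y. escaping_copy a B g y"
proof -
  \<comment> \<open>A fresh node of \<open>a\<close> that is numerically larger than
    \<open>b\<close> and comparable with it would force \<open>b \<preceq> a\<close>, which the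
    depths exclude. Dropping the finitely many smaller ones makes \<open>A\<close> and
    \<open>fresh b\<close> mutually incomparable.\<close>
  define A where "A = {x \<in> fresh a. b < x}"
  have "A = fresh a - {..b}" by (auto simp: A_def)
  then have inf_A: "infinite A" using infinite_fresh[OF a] by simp
  have A: "A \<subseteq> fresh a" by (auto simp: A_def)
  note inf_b = infinite_fresh[OF b]
  have ba: "\<not> b \<preceq> a"
    using card_predecessors_less[of b a] \<open>a \<noteq> b\<close> ab unfolding above_def by force
  have cross: "\<not> x \<sim> v" if x: "x \<in> A" and v: "v \<in> fresh b" for x v
  proof
    assume "x \<sim> v"
    moreover have "b \<preceq> v" using fresh_above[OF v] by (simp add: above_def)
    ultimately have "b \<sim> x" using comparable_below le_trans by blast
    then show False using x ba fresh_smaller[of x a b] by (auto simp: A_def)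
  qed
  define y where "y i = nth_element (if even i then A else fresh b) (i div 2)" for i
  have y_in: "even i \<Longrightarrow> y i \<in> A" "odd i \<Longrightarrow> y i \<in> fresh b" for i
    using nth_element_in inf_A inf_b by (simp_all add: y_def)
  have y_comparable: "i = j" if "y i \<sim> y j" for i j
  proof -
    have eo: "even i \<longleftrightarrow> even j" using cross y_in that by metis
    moreover have "y i = y j"
    proof (cases "even i")
      case True
      then show ?thesis using fresh_antichain[of "y i" a "y j"] that y_in(1) A eo by blast
    next
      case False
      then show ?thesis using fresh_antichain[of "y i" b "y j"] that y_in(2) eo by blast
    qed
    then have "i div 2 = j div 2"
      using eo inj_eq[OF inj_nth_element] inf_A inf_b by (simp add: y_def split: if_splits)
    ultimately show ?thesis by (metis bit_eq_rec)
  qed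
  have inj_y: "inj y" using y_comparable le_refl by (metis injI)
  have range_y: "z \<in> range y \<longleftrightarrow> z \<in> A \<or> z \<in> fresh b" for z
  proof
    assume "z \<in> A \<or> z \<in> fresh b"
    moreover have "y (2 * k) = nth_element A k" "y (2 * k + 1) = nth_element (fresh b) k" for k
      by (simp_all add: y_def)
    ultimately show "z \<in> range y" using nth_element_count_below by (metis rangeI)
  qed (use y_in in blast)
  have pr_A: "prim_rec_pred (\<lambda>_. 0) (\<lambda>e. e 0 \<in> A)"
    unfolding A_def mem_Collect_eq by (intro tree_intros prim_rec_pred_comp1[OF pr_fresh])
  note rules = tree_intros prim_rec_pred_comp1[OF pr_fresh] prim_rec_fun_count_below[OF pr_fresh]
    prim_rec_pred_comp1[OF pr_A] prim_rec_fun_count_below[OF pr_A]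
  have PP: "(if even i then z \<preceq> a \<or> (\<exists>v<z. v \<in> A \<and> count_below A v = i div 2 \<and> z \<preceq> v)
      else z \<preceq> b \<or> (\<exists>v<z. v \<in> fresh b \<and> count_below (fresh b) v = i div 2 \<and> z \<preceq> v))
      \<longleftrightarrow> z \<preceq> y i"
    "(if even i then \<exists>v<z. v \<in> A \<and> count_below A v = i div 2 \<and> v \<preceq> z
      else \<exists>v<z. v \<in> fresh b \<and> count_below (fresh b) v = i div 2 \<and> v \<preceq> z) \<longleftrightarrow> y i \<preceq> z"
    if "z \<notin> range y" for z i
    using that unfolding range_y y_def
    by (simp_all add: nth_fresh[OF A inf_A] nth_fresh[OF subset_refl inf_b])
  have y_eq: "i = j \<longleftrightarrow> y i \<preceq> y j" for i j using y_comparable le_refl by blast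
  interpret delayed_copy T y "\<lambda>_ _. True" "\<lambda>z s. z \<in> A \<or> z \<in> fresh b"
    "\<lambda>z s i. if even i then z \<preceq> a \<or> (\<exists>v<z. v \<in> A \<and> count_below A v = i div 2 \<and> z \<preceq> v)
      else z \<preceq> b \<or> (\<exists>v<z. v \<in> fresh b \<and> count_below (fresh b) v = i div 2 \<and> z \<preceq> v)"
    "\<lambda>z s i. if even i then \<exists>v<z. v \<in> A \<and> count_below A v = i div 2 \<and> v \<preceq> z
      else \<exists>v<z. v \<in> fresh b \<and> count_below (fresh b) v = i div 2 \<and> v \<preceq> z"
    "\<lambda>i j. i = j"
    by unfold_locales
      ((rule inj_y range_y[symmetric] PP y_eq pr_T | assumption | rule TrueI exI) | (intro rules))+
  have "\<exists>C. \<forall>j. \<exists>i. i div 2 = j \<and> (\<psi> (y i) \<notin> fresh a \<or> \<psi> (y i) \<le> C)"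
    if \<psi>: "isomorphism T T \<psi>" for \<psi>
  \<comment> \<open>An automorphism fixing \<open>a\<close> moves \<open>b\<close> elsewhere, and
    the odd half escapes with bound \<open>\<psi> b\<close>; otherwise the even half escapes with
    bound \<open>\<psi> a\<close>.\<close>
  proof (cases "\<psi> a = a")
    case True
    then have "\<psi> b \<noteq> a"
      using \<psi> \<open>a \<noteq> b\<close> unfolding isomorphism_def by (metis bij_is_inj inj_eq)
    then have nle: "\<not> \<psi> b \<preceq> a" by (rule automorphism_not_le[OF \<psi> ab])
    have "\<psi> (y (2 * j + 1)) \<notin> fresh a \<or> \<psi> (y (2 * j + 1)) \<le> \<psi> b" for j
      by (rule escape_fresh[OF \<psi> nle]) (rule fresh_above, rule y_in, simp)
    moreover have "(2 * j + 1) div 2 = j" for j :: nat by simp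
    ultimately show ?thesis by metis
  next
    case False
    then have nle: "\<not> \<psi> a \<preceq> a" by (rule automorphism_not_le[OF \<psi> order_refl])
    have "\<psi> (y (2 * j)) \<notin> fresh a \<or> \<psi> (y (2 * j)) \<le> \<psi> a" for j
      by (rule escape_fresh[OF \<psi> nle]) (rule fresh_above, rule subsetD[OF A], rule y_in, simp)
    moreover have "(2 * j) div 2 = j" for j :: nat by simp
    ultimately show ?thesis by metis
  qed
  then have "escaping_copy a copy label y"
    unfolding escaping_copy_def
    using punctual_copy isomorphism_label inj_y label_attains_y by blast
  then show ?thesis by blast
qed

section \<open>Comparable pairs above one node\<close>

text \<open>
  In the comparability graph on the nodes above \<open>a\<close> that are numerically at most \<open>w\<close>, the
  component of a node \<open>w\<close> of \<open>joins a\<close> is a star with centre \<open>w\<close> and at least one leaf.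
\<close>

definition joins :: "nat \<Rightarrow> nat set" where
  "joins a = {w. above a w \<and> (\<exists>v<w. above a v \<and> v \<sim> w) \<and>
     (\<forall>x<w. \<forall>x'<w. above a x \<longrightarrow> above a x' \<longrightarrow> x \<sim> w \<longrightarrow> x' \<sim> x \<longrightarrow> x' = x)}"

text \<open>Any leaf of the star would serve; the least one is found by a search bounded by
  \<open>w\<close>.\<close>

definition partner :: "nat \<Rightarrow> nat \<Rightarrow> nat" where
  "partner a w = (LEAST v. w \<le> v \<or> above a v \<and> v \<sim> w)"

lemma partner:
  assumes "w \<in> joins a"
  shows partner_less: "partner a w < w" and above_partner: "above a (partner a w)"
    and partner_comparable: "partner a w \<sim> w"
proof -
  obtain v where v: "v < w" "above a v \<and> v \<sim> w" using assms unfolding joins_def by blast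
  have "w \<le> partner a w \<or> above a (partner a w) \<and> partner a w \<sim> w"
    unfolding partner_def by (rule LeastI[of _ w]) simp
  moreover have "partner a w \<le> v"
    unfolding partner_def by (rule Least_le) (use v in blast)
  ultimately show "partner a w < w" "above a (partner a w)" "partner a w \<sim> w"
    using v by auto
qed

lemma joins_above: "w \<in> joins a \<Longrightarrow> above a w"
  by (simp add: joins_def)

lemma joins_star:
  assumes "w \<in> joins a" "above a x" "x < w" "x \<sim> w" "above a x'" "x' < w" "x' \<sim> x"
  shows "x' = x"
  using assms unfolding joins_def by blast

lemma joins_star_partner:
  assumes w: "w \<in> joins a" and z: "above a z" "z < w" and u: "u \<in> {w, partner a w}" "z \<sim> u"
  shows "z \<sim> w"
proof (cases "u = w")
  case False
  then have "z \<sim> partner a w" using u by blast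
  then have "z = partner a w"
    by (rule joins_star[OF w above_partner[OF w] partner_less[OF w] partner_comparable[OF w] z])
  then show ?thesis using partner_comparable[OF w] by simp
qed (use u in simp)

text \<open>Let \<open>w < w'\<close>, so that the earlier pair is numerically below
  \<open>w'\<close>. If one of its members touches the later pair, it is a leaf of the star around
  \<open>w'\<close>; but the other member is a further neighbour of it below
  \<open>w'\<close>.\<close>

lemma joins_separated:
  assumes w: "w \<in> joins a" and w': "w' \<in> joins a"
    and u: "u \<in> {w, partner a w}" and u': "u' \<in> {w', partner a w'}" and c: "u \<sim> u'"
  shows "w = w'"
proof -
  have False if w: "w \<in> joins a" and w': "w' \<in> joins a" and less: "w < w'"
    and u: "u \<in> {w, partner a w}" and u': "u' \<in> {w', partner a w'}" and c: "u \<sim> u'"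
    for w w' u u'
  proof -
    define v where "v = (if u = w then partner a w else w)"
    have v: "above a v" "v < w'" "v \<sim> u" "v \<noteq> u"
      using u less partner[OF w] joins_above[OF w] by (auto simp: v_def)
    have u_less: "above a u" "u < w'"
      using u less partner[OF w] joins_above[OF w] by auto
    have "u \<sim> w'" by (rule joins_star_partner[OF w' u_less u' c])
    from joins_star[OF w' u_less this v(1-3)] v(4) show False by contradiction
  qed
  from this[OF w w' _ u u' c] this[OF w' w _ u' u] c show ?thesis
    by (cases w w' rule: linorder_cases) blast+
qed

text \<open>For each child \<open>c\<close>, take the first number at which the subtree rooted at
  \<open>c\<close> shows two comparable nodes. The earlier nodes of the subtree form an antichain,
  hence a star arises; distinct children have disjoint subtrees.\<close>

lemma infinite_joins:
  assumes a: "infinite (immediate_succs T a)"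
    and succ: "\<And>c. c \<in> immediate_succs T a \<Longrightarrow> immediate_succs T c \<noteq> {}"
  shows "infinite (joins a)"
proof -
  define joined where "joined c w \<longleftrightarrow> c \<preceq> w \<and> (\<exists>v<w. c \<preceq> v \<and> v \<sim> w)" for c w
  define m where "m c = (LEAST w. joined c w)" for c
  have joined_m: "joined c (m c)" if c: "c \<in> immediate_succs T a" for c
  proof -
    obtain x where "above c x"
      using succ[OF c] by (auto simp: immediate_succs_iff)
    then have "joined c (max c x)"
      unfolding joined_def above_def using le_refl by (cases c x rule: linorder_cases) auto
    then show ?thesis unfolding m_def by (rule LeastI)
  qed
  have m_joins: "m c \<in> joins a" if c: "c \<in> immediate_succs T a" for c
  proof -
    have ac: "above a c" using c unfolding immediate_succs_iff by blast
    have cm: "c \<preceq> m c" and ex: "\<exists>v<m c. c \<preceq> v \<and> v \<sim> m c"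
      using joined_m[OF c] unfolding joined_def by blast+
    have cone: "c \<preceq> x" if "above a x" "x \<sim> w" "c \<preceq> w" for x w
      using immediate_succs_comparable[OF c that(1)] that le_trans comparable_below by blast
    have "x' = x" if x: "x < m c" "above a x" "x \<sim> m c" and x': "x' < m c" "above a x'" "x' \<sim> x"
      for x x'
    proof (rule ccontr)
      assume "x' \<noteq> x"
      have "c \<preceq> x" by (rule cone[OF x(2,3) cm])
      moreover from this have "c \<preceq> x'" by (rule cone[OF x'(2,3)])
      ultimately have "joined c (max x x')"
        using \<open>x' \<noteq> x\<close> x'(3) unfolding joined_def by (cases x x' rule: linorder_cases) auto
      then have "m c \<le> max x x'" unfolding m_def by (rule Least_le)
      then show False using x(1) x'(1) by simp
    qed
    then show ?thesis
      unfolding joins_def using ex above_trans[OF ac] cm by blast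
  qed
  have "inj_on m (immediate_succs T a)"
    by (rule inj_onI) (metis joined_m joined_def immediate_succs_below_unique)
  moreover have "m ` immediate_succs T a \<subseteq> joins a" using m_joins by blast
  ultimately show ?thesis using a by (meson finite_imageD finite_subset)
qed

lemma pr_partner:
  assumes "prim_rec_fun (\<lambda>_. 0) t" shows "prim_rec_fun (\<lambda>_. 0) (\<lambda>e. partner a (t e))"
proof -
  have "prim_rec_fun (\<lambda>_. 0) (\<lambda>e. partner a (e 0))"
    unfolding partner_def by (intro tree_intros)
  from prim_rec_fun_comp1[OF this assms] show ?thesis .
qed

lemma pr_joins: "prim_rec_pred (\<lambda>_. 0) (\<lambda>e. e 0 \<in> joins a)"
  unfolding joins_def mem_Collect_eq by (intro tree_intros)

lemma escaping_copy_succs: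
  assumes a: "infinite (immediate_succs T a)"
    and succ: "\<And>c. c \<in> immediate_succs T a \<Longrightarrow> immediate_succs T c \<noteq> {}"
  shows "\<exists>B g y. escaping_copy a B g y"
proof -
  define D where "D = joins a"
  have inf: "infinite D" unfolding D_def by (rule infinite_joins[OF a succ])
  \<comment> \<open>Orienting each pair by the tree order leaves
    \<open>y (2 * k) \<preceq> y (2 * k + 1)\<close> as the only relations between distinct early
    nodes.\<close>
  define low where "low w = (if partner a w \<preceq> w then partner a w else w)" for w
  define high where "high w = (if partner a w \<preceq> w then w else partner a w)" for w
  define el where "el i w = (if even i then low w else high w)" for i :: nat and w
  define y where "y i = el i (nth_element D (i div 2))" for i
  have el_in: "el i w \<in> {w, partner a w}" for i w by (auto simp: el_def low_def high_def)
  have low_high: "low w \<preceq> high w" "low w \<noteq> high w" if "w \<in> D" for w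
    using partner[of w a] that unfolding D_def low_def high_def by auto
  have el_above: "above a (el i w)" if "w \<in> D" for i w
    using el_in[of i w] above_partner joins_above that unfolding D_def by auto
  have w_in: "nth_element D k \<in> D" for k by (rule nth_element_in[OF inf])
  have same: "i div 2 = j div 2" if "y i \<sim> y j" for i j
    using joins_separated[OF w_in[unfolded D_def] w_in[unfolded D_def] el_in el_in]
      that inj_eq[OF inj_nth_element[OF inf]] unfolding y_def D_def by metis
  have y_le: "(i = j \<or> even i \<and> j = Suc i) \<longleftrightarrow> y i \<preceq> y j" for i j
  proof
    assume "i = j \<or> even i \<and> j = Suc i"
    then show "y i \<preceq> y j"
      using low_high w_in le_refl by (auto simp: y_def el_def)
  next
    assume le: "y i \<preceq> y j"
    then have d: "i div 2 = j div 2" using same by blast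
    have "\<not> (odd i \<and> even j)"
      using le low_high[OF w_in, of "j div 2"] le_antisym d unfolding y_def el_def by metis
    then show "i = j \<or> even i \<and> j = Suc i" using d by presburger
  qed
  have inj_y: "inj y"
    by (rule injI) (metis y_le le_refl even_Suc n_not_Suc_n)
  \<comment> \<open>While \<open>z\<close> has no neighbour above \<open>a\<close>, it may still
    enter a pair. Once a neighbour \<open>t \<le> s\<close> is known, \<open>z\<close> cannot touch
    a pair whose centre exceeds \<open>z + s\<close>: a leaf has no other neighbour below the
    centre. A neighbour always exists, as the subtree of a child has at least two nodes.\<close>
  define W where "W z s \<longleftrightarrow> \<not> above a z \<or> (\<exists>t<Suc s. above a t \<and> t \<noteq> z \<and> t \<sim> z)" for z s
  have W_ex: "\<exists>s. W z s" for z
  proof (cases "above a z")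
    case True
    then obtain c where c: "c \<in> immediate_succs T a" "c \<preceq> z"
      using ex_immediate_succ_below by blast
    obtain x where x: "x \<in> immediate_succs T c" using succ[OF c(1)] by blast
    have "above a c" using c unfolding immediate_succs_iff by blast
    moreover have "above a x" "c \<preceq> x" "x \<noteq> c"
      using x above_trans[OF \<open>above a c\<close>] unfolding immediate_succs_iff above_def by blast+
    ultimately have "\<exists>t. above a t \<and> t \<noteq> z \<and> t \<sim> z" using c(2) by blast
    then show ?thesis unfolding W_def by blast
  qed (simp add: W_def)
  have W_mono: "W z t" if "W z s" "s \<le> t" for z s t
    using that unfolding W_def by (meson Suc_le_mono less_le_trans)
  have W_far: False
    if W: "W z s" and w: "w \<in> D" "\<not> w < Suc (z + s)" and z: "above a z" "z \<sim> w" for z s w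
  proof -
    obtain t where t: "t < Suc s" "above a t" "t \<noteq> z" "t \<sim> z" using W z(1) unfolding W_def by blast
    have "z < w" "t < w" using w(2) t(1) by simp_all
    from joins_star[OF w(1)[unfolded D_def] z(1) this(1) z(2) t(2) this(2) t(4)] t(3)
    show False by contradiction
  qed
  have far: "z \<preceq> a"
    if W: "W z s" and w: "w \<in> D" "\<not> w < Suc (z + s)" and c: "z \<sim> el i w" for z s w i
  proof (rule ccontr)
    assume "\<not> z \<preceq> a"
    moreover from this have "z \<sim> a"
      using c el_above[OF w(1), of i] comparable_below le_trans unfolding above_def by blast
    ultimately have z: "above a z" using le_refl unfolding above_def by blast
    have "z \<sim> w"
      by (rule joins_star_partner[OF w(1)[unfolded D_def] z _ el_in c]) (use w(2) in simp)
    then show False by (rule W_far[OF W w z])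
  qed
  have range_y: "z \<in> range y \<longleftrightarrow> (\<exists>w. w \<in> D \<and> (z = w \<or> z = partner a w))" for z
  proof
    assume "\<exists>w. w \<in> D \<and> (z = w \<or> z = partner a w)"
    then obtain w where w: "w \<in> D" "z = w \<or> z = partner a w" by blast
    have "nth_element D (count_below D w) = w" by (rule nth_element_count_below[OF w(1)])
    then have "y (2 * count_below D w) = low w" "y (2 * count_below D w + 1) = high w"
      by (simp_all add: y_def el_def)
    moreover have "z = low w \<or> z = high w" using w(2) by (auto simp: low_def high_def)
    ultimately show "z \<in> range y" by (metis rangeI)
  next
    assume "z \<in> range y"
    then obtain i where "z = el i (nth_element D (i div 2))" unfolding y_def by (rule rangeE)
    then show "\<exists>w. w \<in> D \<and> (z = w \<or> z = partner a w)"
      using w_in el_in[of i "nth_element D (i div 2)"] by auto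
  qed
  have M: "(\<exists>w<Suc (z + s). w \<in> D \<and> (z = w \<or> z = partner a w)) \<longleftrightarrow> z \<in> range y" if W: "W z s" for z s
  proof -
    have False if w: "w \<in> D" "\<not> w < Suc (z + s)" "z = w \<or> z = partner a w" for w
      using W_far[OF W w(1,2)] w partner[OF w(1)[unfolded D_def]] by auto
    then show ?thesis unfolding range_y by blast
  qed
  have PP: "(z \<preceq> a \<or> (\<exists>w<Suc (z + s). w \<in> D \<and> count_below D w = i div 2 \<and> z \<preceq> el i w)) \<longleftrightarrow> z \<preceq> y i"
    "(\<exists>w<Suc (z + s). w \<in> D \<and> count_below D w = i div 2 \<and> el i w \<preceq> z) \<longleftrightarrow> y i \<preceq> z"
    if W: "W z s" for z s i
  proof -
    define w where "w = nth_element D (i div 2)"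
    have w: "w \<in> D" "count_below D w = i div 2"
      using nth_element[OF inf] by (simp_all add: w_def)
    have unique: "v = w" if "v \<in> D" "count_below D v = i div 2" for v
      using nth_element_count_below[OF that(1)] that(2) by (simp add: w_def)
    have y: "y i = el i w" by (simp add: y_def w_def)
    have "z \<preceq> el i w" if "z \<preceq> a"
      using le_trans[OF that] el_above[OF w(1)] by (simp add: above_def)
    then show "(z \<preceq> a \<or> (\<exists>w<Suc (z + s). w \<in> D \<and> count_below D w = i div 2 \<and> z \<preceq> el i w))
        \<longleftrightarrow> z \<preceq> y i"
      unfolding y using w unique far[OF W w(1), of i] by blast
    have "\<not> el i w \<preceq> z" if "z \<preceq> a"
      using that le_trans not_le_above[OF el_above[OF w(1)]] by blast
    then show "(\<exists>w<Suc (z + s). w \<in> D \<and> count_below D w = i div 2 \<and> el i w \<preceq> z) \<longleftrightarrow> y i \<preceq> z"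
      unfolding y using w unique far[OF W w(1), of i] by blast
  qed
  have pr_D: "prim_rec_pred (\<lambda>_. 0) (\<lambda>e. e 0 \<in> D)" unfolding D_def by (rule pr_joins)
  note rules = tree_intros pr_partner prim_rec_pred_comp1[OF pr_D] prim_rec_fun_count_below[OF pr_D]
  interpret delayed_copy T y W "\<lambda>z s. \<exists>w<Suc (z + s). w \<in> D \<and> (z = w \<or> z = partner a w)"
    "\<lambda>z s i. z \<preceq> a \<or> (\<exists>w<Suc (z + s). w \<in> D \<and> count_below D w = i div 2 \<and> z \<preceq> el i w)"
    "\<lambda>z s i. \<exists>w<Suc (z + s). w \<in> D \<and> count_below D w = i div 2 \<and> el i w \<preceq> z"
    "\<lambda>i j. i = j \<or> even i \<and> j = Suc i"
    by unfold_locales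
      (assumption | rule inj_y W_ex W_mono M PP y_le pr_T
        | (unfold W_def el_def low_def high_def, intro rules) | intro rules)+
  have "\<exists>C. \<forall>j. \<exists>i. i div 2 = j \<and> (\<psi> (y i) \<notin> fresh a \<or> \<psi> (y i) \<le> C)"
    if \<psi>: "isomorphism T T \<psi>" for \<psi>
  proof -
    \<comment> \<open>The images of a pair stay distinct and comparable, so they are not both in an
      antichain, whatever \<open>C\<close> is.\<close>
    have "\<psi> (y (2 * j)) \<notin> fresh a \<or> \<psi> (y (2 * j + 1)) \<notin> fresh a" for j
    proof -
      have "y (2 * j) \<preceq> y (2 * j + 1)" using y_le[of "2 * j" "2 * j + 1"] by simp
      then have "\<psi> (y (2 * j)) \<preceq> \<psi> (y (2 * j + 1))" using \<psi> unfolding isomorphism_def by blast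
      moreover have "\<psi> (y (2 * j)) \<noteq> \<psi> (y (2 * j + 1))"
        using \<psi> inj_y unfolding isomorphism_def by (simp add: bij_is_inj inj_eq)
      ultimately show ?thesis using fresh_antichain by blast
    qed
    moreover have "(2 * j) div 2 = j" "(2 * j + 1) div 2 = j" for j :: nat by simp_all
    ultimately show ?thesis by metis
  qed
  then have "escaping_copy a copy label y"
    unfolding escaping_copy_def
    using punctual_copy isomorphism_label inj_y label_attains_y by blast
  then show ?thesis by blast
qed

section \<open>From isomorphisms to a bound on the running time\<close>

lemma computable_le_PrCat:
  assumes a: "infinite (immediate_succs T a)" and B2: "escaping_copy a B2 g2 y"
    and d: "d \<in> PrCat T" and f: "computable f"
  shows "f \<le>PRdeg d"
proof -
  obtain p where p: "oracle_free p" "\<And>x. computes (\<lambda>_. 0) p [x] (f x)"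
    using f unfolding computable_def by blast
  obtain F where F: "fuel_evaluator 1 p F" using ex_fuel_evaluator[OF p(1)] by blast
  define W where "W x s \<longleftrightarrow> F s (\<lambda>_. x) \<noteq> 0" for x s
  have F_f: "\<exists>s. F s (\<lambda>_. x) = Suc (f x)" for x
    by (rule fuel_evaluator_complete[OF F]) (simp add: p(2))
  \<comment> \<open>Evaluators are only known to be complete and monotone. A nonzero output is
    nevertheless correct, since outputs for two amounts of fuel agree at the larger one.\<close>
  have W_value: "F s (\<lambda>_. x) = Suc (f x)" if "W x s" for x s
  proof -
    obtain v where v: "F s (\<lambda>_. x) = Suc v" using \<open>W x s\<close> unfolding W_def by (metis not0_implies_Suc)
    obtain r where r: "F r (\<lambda>_. x) = Suc (f x)" using F_f by blast
    have "F (max r s) (\<lambda>_. x) = Suc v" by (rule fuel_evaluator_mono[OF F, OF v]) simp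
    moreover have "F (max r s) (\<lambda>_. x) = Suc (f x)" by (rule fuel_evaluator_mono[OF F, OF r]) simp
    ultimately show ?thesis using v by simp
  qed
  have W_ex: "\<exists>s. W x s" for x using F_f[of x] unfolding W_def by (metis nat.distinct(1))
  have W_mono: "W x t" if "W x s" "s \<le> t" for x s t
    using fuel_evaluator_mono[OF F, OF W_value[OF that(1)] that(2)] unfolding W_def by simp
  have pr_F: "prim_rec_fun g (\<lambda>e. F (t e) (\<lambda>_. u e))"
    if "prim_rec_fun g t" "prim_rec_fun g u" for g t u
    by (rule fuel_evaluator_compose[OF F that])
  have pr_W: "prim_rec_pred g (\<lambda>e. W (u e) (t e))"
    if "prim_rec_fun g t" "prim_rec_fun g u" for g t u
    unfolding W_def by (intro prim_rec_intros pr_F that)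
  have "\<exists>B g. punctual B \<and> isomorphism B T g \<and>
      (\<forall>n x. g n \<notin> fresh a \<longrightarrow> x \<le> g n \<longrightarrow> W x n)"
    by (rule antichain_copy[OF a W_ex]) (erule (1) W_mono | rule pr_W prim_rec_fun_var)+
  then obtain B1 g1 where B1: "punctual B1" "isomorphism B1 T g1"
    and g1: "\<And>n x. g1 n \<notin> fresh a \<Longrightarrow> x \<le> g1 n \<Longrightarrow> W x n"
    by blast
  have B2': "punctual B2" "isomorphism B2 T g2" using B2 unfolding escaping_copy_def by blast+
  obtain f1 where f1: "isomorphism T B1 f1" "f1 \<le>PRdeg d"
    using d B1 isomorphism_inv[OF B1(2)] unfolding PrCat_def isomorphic_def by blast
  obtain f2 where f2: "isomorphism T B2 f2" "inv f2 \<le>PRdeg d"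
    using d B2' isomorphism_inv[OF B2'(2)] unfolding PrCat_def isomorphic_def by blast
  have d_deg: "d \<in> pr_degrees" using d unfolding PrCat_def by blast
  obtain \<delta> where \<delta>: "\<delta> \<in> d" using f1(2) unfolding pr_le_degree_def by blast
  define h where "h n = f1 (inv f2 n)" for n
  have pr_h: "prim_rec_fun \<delta> (\<lambda>e. h (t e))" if "prim_rec_fun \<delta> t" for t
    unfolding h_def
    by (rule prim_rec_fun_oracle[OF pr_le_degree_member[OF d_deg f1(2) \<delta>]
          prim_rec_fun_oracle[OF pr_le_degree_member[OF d_deg f2(2) \<delta>] that]])
  \<comment> \<open>Read through the labels of the two copies, the map \<open>h\<close> on positions
    becomes an automorphism, to which the escape property applies.\<close>
  define \<psi> where "\<psi> = g1 \<circ> (f1 \<circ> (inv f2 \<circ> inv g2))"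
  have \<psi>: "isomorphism T T \<psi>"
    unfolding \<psi>_def
    by (rule isomorphism_comp[OF isomorphism_comp[OF isomorphism_comp[OF isomorphism_inv
              isomorphism_inv]]]) (rule B2' f1 f2 B1)+
  have \<psi>_g2: "\<psi> (g2 n) = g1 (h n)" for n
    using B2'(2) unfolding isomorphism_def \<psi>_def h_def by (simp add: bij_is_inj)
  obtain C where "\<forall>j. \<exists>i. i div 2 = j \<and> (\<psi> (y i) \<notin> fresh a \<or> \<psi> (y i) \<le> C)"
    using B2 \<psi> unfolding escaping_copy_def by blast
  then obtain i where i: "\<And>j. i j div 2 = j" "\<And>j. \<psi> (y (i j)) \<notin> fresh a \<or> \<psi> (y (i j)) \<le> C"
    by metis
  \<comment> \<open>Put \<open>M = x + C + 1\<close>. In the first \<open>M + 1\<close> pairs the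
    escaping members have distinct images, so some image is at least \<open>M\<close>; it exceeds
    \<open>C\<close>, hence is not fresh, and is at least \<open>x\<close>. Its index is at most
    \<open>2 * M + 1\<close>, so its position in \<open>B2\<close> is at most
    \<open>4 * M + 3\<close>.\<close>
  define b where "b x = 4 * (x + C + 1) + 4" for x
  have ex_W: "\<exists>k<b x. W x (h k)" for x
  proof -
    define M where "M = x + C + 1"
    have "inj (\<lambda>j. \<psi> (y (i j)))"
    proof (rule injI)
      fix j k assume "\<psi> (y (i j)) = \<psi> (y (i k))"
      moreover have "inj \<psi>" "inj y"
        using \<psi> B2 unfolding isomorphism_def escaping_copy_def by (auto simp: bij_is_inj)
      ultimately have "i j = i k" by (simp add: inj_eq)
      then show "j = k" using i(1) by metis
    qed
    then have "card ((\<lambda>j. \<psi> (y (i j))) ` {..M}) = Suc M"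
      using card_image inj_on_subset subset_UNIV by (metis card_atMost)
    then have "\<not> (\<lambda>j. \<psi> (y (i j))) ` {..M} \<subseteq> {..<M}"
      using card_mono[of "{..<M}" "(\<lambda>j. \<psi> (y (i j))) ` {..M}"] by auto
    then obtain j where j: "j \<le> M" "M \<le> \<psi> (y (i j))" by (auto simp: image_subset_iff not_less)
    obtain k where k: "k \<le> 2 * i j + 1" "g2 k = y (i j)"
      using B2 unfolding escaping_copy_def by blast
    have "i j \<le> 2 * M + 1" using i(1)[of j] j(1) by linarith
    then have "k < b x" using k(1) unfolding b_def M_def by linarith
    moreover have "W x (h k)"
    proof (rule g1)
      show "g1 (h k) \<notin> fresh a" "x \<le> g1 (h k)"
        using i(2)[of j] j(2) \<psi>_g2[of k] k(2) unfolding M_def by auto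
    qed
    ultimately show ?thesis by blast
  qed
  \<comment> \<open>The search tests the fuel \<open>h k\<close> directly, so neither the escaping
    index nor \<open>\<psi>\<close> has to be computed.\<close>
  define K where "K x = (LEAST k. b x \<le> k \<or> W x (h k))" for x
  have "W x (h (K x))" for x
  proof -
    obtain k where k: "k < b x" "W x (h k)" using ex_W by blast
    have "b x \<le> K x \<or> W x (h (K x))" unfolding K_def by (rule LeastI[of _ k]) (use k in simp)
    moreover have "K x \<le> k" unfolding K_def by (rule Least_le) (use k in simp)
    ultimately show ?thesis using k by simp
  qed
  then have f_eq: "f x = F (h (K x)) (\<lambda>_. x) - 1" for x
    using W_value[of x "h (K x)"] by simp
  have b_eq: "b x = x + C + 1 + (x + C + 1) + (x + C + 1) + (x + C + 1) + 4" for x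
    by (simp add: b_def)
  have "prim_rec_fun \<delta> (\<lambda>e. K (e 0))"
    unfolding K_def b_eq by (intro prim_rec_intros pr_W pr_h)
  then have "prim_rec_fun \<delta> (\<lambda>e. f (e 0))"
    unfolding f_eq by (intro prim_rec_fun_pred pr_F pr_h prim_rec_fun_var)
  then show ?thesis using \<delta> unfolding pr_le_degree_def pr_le_iff_prim_rec_fun by blast
qed

end

theorem theorem5p2:
  fixes T :: "nat rel"
  assumes "punctual T" and "is_tree T" and "finite_height T"
    and "(\<exists>a b. a \<noteq> b \<and> infinite (immediate_succs T a) \<and> infinite (immediate_succs T b)) \<or>
         ((\<exists>!a. infinite (immediate_succs T a)) \<and>
          (\<forall>a. infinite (immediate_succs T a) \<longrightarrow>
             (\<forall>b \<in> immediate_succs T a. immediate_succs T b \<noteq> {})))"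
  shows "PrCat T \<subseteq> Cone_computable"
proof -
  interpret punctual_tree T by unfold_locales (rule assms)+
  have "\<exists>a B g y. infinite (immediate_succs T a) \<and> escaping_copy a B g y"
    using assms(4)
  proof
    assume "\<exists>a b. a \<noteq> b \<and> infinite (immediate_succs T a) \<and> infinite (immediate_succs T b)"
    then obtain a b where "a \<noteq> b" "infinite (immediate_succs T a)" "infinite (immediate_succs T b)"
      by blast
    \<comment> \<open>By symmetry the less deep of the two nodes takes the role of
      \<open>a\<close>.\<close>
    then show ?thesis
      using escaping_copy_two_infinite[of a b] escaping_copy_two_infinite[of b a]
        nat_le_linear[of "card (predecessors T a)" "card (predecessors T b)"] by blast
  next
    assume "(\<exists>!a. infinite (immediate_succs T a)) \<and>
          (\<forall>a. infinite (immediate_succs T a) \<longrightarrow>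
             (\<forall>b \<in> immediate_succs T a. immediate_succs T b \<noteq> {}))"
    then obtain a where "infinite (immediate_succs T a)"
      "\<And>b. b \<in> immediate_succs T a \<Longrightarrow> immediate_succs T b \<noteq> {}" by blast
    then show ?thesis using escaping_copy_succs[of a] by blast
  qed
  then show ?thesis
    using computable_le_PrCat unfolding Cone_computable_def PrCat_def by blast
qed

end
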